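(* Suppose $H$ is a High-Order ARZE-MCBF for the multi-agent dynamics $\dot{\vec x}=F(\vec x)+G(\vec x)\vec u_k$, with constants $c_{\alpha_1},\dots,c_{\alpha_r}>0$; that is, $H$ is at least $r$-times continuously differentiable and for all $\vec x\in D$ there exists $\vec u^{\mathcal N}\in\mathcal U^{\mathcal N}$ with $$\Psi_r(\vec x,\vec u^{\mathcal N})\succeq\delta_r(\Delta_t,c_{\alpha_r})I .$$ Let $K_r^{\mathcal N}(\vec x)=\{\vec u^{\mathcal N}\in\mathcal U^{\mathcal N}:\Psi_r(\vec x,\vec u^{\mathcal N})\succeq\delta_r(\Delta_t,c_{\alpha_r})I\}$. Then any feedback control law for the normal agents $\vec\kappa^{\mathcal N}(\cdot)$, applied in zero-order-hold fashion, that satisfies $\vec\kappa^{\mathcal N}(\vec x(t_k))\in K_r^{\mathcal N}(\vec x(t_k))$ for all $k\in\mathbb N$ renders the set $$S_Q=\bigcap_{q=1}^rS_q,\qquad S_q=\{\vec x\in\mathbb R^n:\Psi_{q-1}(\vec x)\succeq0\},$$ forward invariant for the closed-loop system (in which each adversarial agent $j\in\mathcal A$ applies $u^j_{\min}(\vec x(t_k))$ on $[t_k,t_{k+1})$).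
   Context: System: there are $N$ agents; agent $i$ has state $x^i\in\mathbb R^{n^i}$, input $u^i\in\mathbb R^{m^i}$ and dynamics $\dot x^i=f^i(x^i)+g^i(x^i)u^i$, with $f^i:\mathbb R^{n^i}\to\mathbb R^{n^i}$ and $g^i:\mathbb R^{n^i}\to\mathbb R^{n^i\times m^i}$ locally Lipschitz. Let $n=\sum_i n^i$, $m=\sum_i m^i$, $\vec x=(x^1,\dots,x^N)\in\mathbb R^n$, $\vec u=(u^1,\dots,u^N)\in\mathbb R^m$, $F(\vec x)=(f^1(x^1),\dots,f^N(x^N))$ (stacked) and $G(\vec x)=\mathrm{blkdiag}(g^1(x^1),\dots,g^N(x^N))$. Inputs are zero-order-hold: with sampling times $t_k=t_0+k\Delta_t$, $k\in\mathbb N$, $\Delta_t>0$, every agent's input is constant, $\vec u(t)=\vec u_k$, on each $[t_k,t_{k+1})$, so $\dot{\vec x}=F(\vec x)+G(\vec x)\vec u_k$ there. Each $u^i$ is constrained to a nonempty convex compact set $\mathcal U^i\subset\mathbb R^{m^i}$; $\mathcal U=\mathcal U^1\times\cdots\times\mathcal U^N$ and $b_u=\sup_{\vec u\in\mathcal U}\|\vec u\|$. Norms and order: $\|\cdot\|$ is the Euclidean norm on vectors, the spectral norm on matrices, and the corresponding induced norm on linear maps. $\mathbb S^p$ is the set of real symmetric $p\times p$ matrices; $A\succeq B$ means $A-B$ is positive semidefinite (Loewner order); $I$ is the identity. Safe set: $H:\mathbb R^n\to\mathbb S^p$ is continuously differentiable with locally Lipschitz Jacobian, and $S=\{\vec x\in\mathbb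 R^n:H(\vec x)\succeq0\}$. For a differentiable $M:\mathbb R^n\to\mathbb S^p$, Lie derivatives are entrywise: $[\mathcal L_FM]_{ij}=\mathcal L_F(M_{ij})$, and, with $G_j$ the $j$th column of $G$, $(\mathcal L_GM(\vec x))(\vec u)=\sum_{j=1}^m\mathcal L_{G_j}M(\vec x)[\vec u]_j\in\mathbb S^p$, a linear map $\mathbb R^m\to\mathbb S^p$. For an agent $i$, $(\mathcal L_{g^i}M(\vec x))(u^i)$ denotes the part of this sum coming from the columns of $G$ belonging to agent $i$. Along the dynamics, $\dot M=\mathcal L_FM+(\mathcal L_GM)(\vec u)$. Adversaries: $\mathcal A\subset\{1,\dots,N\}$ is the set of adversarial agents and $\mathcal N=\{1,\dots,N\}\setminus\mathcal A$ the set of normal agents; $\mathcal U^{\mathcal N}=\prod_{i\in\mathcal N}\mathcal U^i$, $\vec u^{\mathcal N}=(u^i)_{i\in\mathcal N}$. An adversarial agent $j$ applies at every sampling time $t_k$ the input $u^j_{\min}(\vec x(t_k))$, where $u^j_{\min}(\vec x)\in\arg\min_{u\in\mathcal U^j}\,[(\mathcal L_{g^j}H(\vec x))(u)]$ is a fixed selection of a minimizer, the minimization being in the Loewner order (i.e. $u^j_{\min}(\vec x)\in\mathcal U^j$ and its value $(\mathcal L_{g^j}H(\vec x))(u^j_{\min}(\vec x))$ is minimal for $\preceq$ among the values $(\mathcal L_{g^j}H(\vec x))(u)$, $u\in\mathcal U^j$). High relative degree: given constants $c_{\alpha_1},\dots,c_{\alpha_r}$, define $$\Psi_0(\vec x)=H(\vec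 x),\qquad \Psi_q(\vec x)=\dot\Psi_{q-1}(\vec x)+c_{\alpha_q}\Psi_{q-1}(\vec x)\quad(1\le q\le r-1),$$ $$\Psi_r(\vec x,\vec u^{\mathcal N})=\mathcal L_F\Psi_{r-1}(\vec x)+\sum_{i\in\mathcal N}(\mathcal L_{g^i}\Psi_{r-1}(\vec x))(u^i)+\sum_{j\in\mathcal A}(\mathcal L_{g^j}\Psi_{r-1}(\vec x))(u^j_{\min}(\vec x))+c_{\alpha_r}\Psi_{r-1}(\vec x).$$ Here $r\ge1$ is the smallest integer such that the control inputs $\vec u^{\mathcal N}$ or $(u^j_{\min})_{j\in\mathcal A}$ appear in $\Psi_r$ while being absent from $\Psi_q$ for $0\le q\le r-1$ (so $\mathcal L_G\Psi_{q}\equiv0$ and $\dot\Psi_{q}=\mathcal L_F\Psi_{q}$ for $0\le q\le r-2$); it is assumed that both the normal and the adversarial inputs appear in the expression for $\Psi_r$. The functions $\Psi_q$, $0\le q\le r-1$, are continuously differentiable, so that these expressions are defined. Standing assumptions: $D\subseteq\mathbb R^n$ is a domain with $S\subset D$; the maps $H$, $\mathcal L_FH$, $\mathcal L_GH$ are Lipschitz on $D$ with constants $L_H,L_{FH},L_{GH}\ge0$ respectively; the maps $\mathcal L_F\Psi_{r-1}$ and $\mathcal L_G\Psi_{r-1}$ are Lipschitz on $D$ with constants $\widehat L_{FH},\widehat L_{GH}$ respectively; and there are finite $b_F,b_G>0$ with $\sup_{\vec x\in D}\|F(\vec x)\|\le b_F$ and $\sup_{\vec x\in D}\|G(\vec x)\|\le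 b_G$. Define $$\delta_r(\Delta_t,c_{\alpha_r})=\Delta_t(\widehat L_{FH}+\widehat L_{GH}b_u+c_{\alpha_r}L_H)(b_F+b_Gb_u).$$ Forward invariance: a set $\mathcal C\subset\mathbb R^n$ is forward invariant for the closed-loop system if $\vec x(t_0)\in\mathcal C$ implies $\vec x(t)\in\mathcal C$ for all $t\ge t_0$. *)

theory Defs
  imports "HOL-Analysis.Analysis"
begin

text \<open>
  Heterogeneous agents. The stacked spaces are \<open>real ^ 'n\<close> and \<open>real ^ 'm\<close>, and a map
  \<open>own :: 'k \<Rightarrow> 'a\<close> says which agent each coordinate belongs to. The individual space of agent
  \<open>i\<close> (whose dimension is the number of \<open>k\<close> with \<open>own k = i\<close>, so it may depend on \<open>i\<close>) is the
  coordinate subspace \<open>agent_space own i\<close>, isometric to the Euclidean space of that dimension.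
\<close>

definition agent_space :: "('k::finite \<Rightarrow> 'a) \<Rightarrow> 'a \<Rightarrow> (real ^ 'k) set" where
  "agent_space own i = {v. \<forall>k. own k \<noteq> i \<longrightarrow> v $ k = 0}"

definition block :: "('k::finite \<Rightarrow> 'a) \<Rightarrow> 'a \<Rightarrow> real ^ 'k \<Rightarrow> real ^ 'k" where
  "block own i v = (\<chi> k. if own k = i then v $ k else 0)"

definition stack :: "('k::finite \<Rightarrow> 'a) \<Rightarrow> ('a \<Rightarrow> real ^ 'k) \<Rightarrow> real ^ 'k" where
  "stack own w = (\<chi> k. w (own k) $ k)"

text \<open>Matrices whose only nonzero entries lie in the diagonal block of agent \<open>i\<close>.\<close>

definition agent_mats ::
    "('n::finite \<Rightarrow> 'a) \<Rightarrow> ('m::finite \<Rightarrow> 'a) \<Rightarrow> 'a \<Rightarrow> (real ^ 'm ^ 'n) set" where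
  "agent_mats sx su i = {B. \<forall>k l. sx k \<noteq> i \<or> su l \<noteq> i \<longrightarrow> B $ k $ l = 0}"

definition stacked_drift ::
    "('n::finite \<Rightarrow> 'a) \<Rightarrow> ('a \<Rightarrow> real ^ 'n \<Rightarrow> real ^ 'n) \<Rightarrow> real ^ 'n \<Rightarrow> real ^ 'n" where
  "stacked_drift sx f x = stack sx (\<lambda>i. f i (block sx i x))"

definition blkdiag_input ::
    "('n::finite \<Rightarrow> 'a) \<Rightarrow> ('m::finite \<Rightarrow> 'a) \<Rightarrow> ('a \<Rightarrow> real ^ 'n \<Rightarrow> real ^ 'm ^ 'n)
      \<Rightarrow> real ^ 'n \<Rightarrow> real ^ 'm ^ 'n" where
  "blkdiag_input sx su g x =
     (\<chi> k l. if sx k = su l then g (sx k) (block sx (sx k) x) $ k $ l else 0)"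

definition input_set :: "('m::finite \<Rightarrow> 'a) \<Rightarrow> ('a \<Rightarrow> (real ^ 'm) set) \<Rightarrow> (real ^ 'm) set" where
  "input_set su U = {u. \<forall>i. block su i u \<in> U i}"

text \<open>
  The library norm on matrices is the Frobenius norm, so the spectral norm is introduced explicitly;
  \<open>ind_norm\<close> is the norm of a linear map into matrices induced by the Euclidean and the spectral
  norm (the same supremum as in \<open>onorm\<close>, which would use the Frobenius norm).
\<close>

definition spectral_norm :: "real ^ 'q::finite ^ 'p::finite \<Rightarrow> real" where
  "spectral_norm A = onorm (\<lambda>v. A *v v)"

definition ind_norm :: "(real ^ 'm::finite \<Rightarrow> real ^ 'q::finite ^ 'p::finite) \<Rightarrow> real" where
  "ind_norm T = (SUP u. spectral_norm (T u) / norm u)"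

definition psd :: "real ^ 'p::finite ^ 'p \<Rightarrow> bool" where
  "psd A \<longleftrightarrow> transpose A = A \<and> (\<forall>v. 0 \<le> v \<bullet> (A *v v))"

definition loewner_le :: "real ^ 'p::finite ^ 'p \<Rightarrow> real ^ 'p ^ 'p \<Rightarrow> bool"  (infix "\<preceq>\<^sub>L" 50) where
  "A \<preceq>\<^sub>L B \<longleftrightarrow> psd (B - A)"

text \<open>Minimizers for the (partial) Loewner order: the value is a minimal element among all values.\<close>

definition loewner_argmin :: "'u set \<Rightarrow> ('u \<Rightarrow> real ^ 'p::finite ^ 'p) \<Rightarrow> 'u set" where
  "loewner_argmin V \<phi> = {u \<in> V. \<forall>v\<in>V. \<phi> v \<preceq>\<^sub>L \<phi> u \<longrightarrow> \<phi> v = \<phi> u}"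

text \<open>
  \<open>k\<close>-fold continuous differentiability on the whole space: all iterated directional derivatives up
  to order \<open>k\<close> exist and are continuous. In finite dimensions this is \<open>C\<^sup>k\<close>.
\<close>

primrec cont_diff ::
    "nat \<Rightarrow> ('s::real_normed_vector \<Rightarrow> 't::real_normed_vector) \<Rightarrow> bool" where
  "cont_diff 0 M \<longleftrightarrow> continuous_on UNIV M"
| "cont_diff (Suc k) M \<longleftrightarrow> (\<forall>x. M differentiable (at x)) \<and>
     (\<forall>v. cont_diff k (\<lambda>x. frechet_derivative M (at x) v))"

text \<open>The real parameter of \<open>local_lipschitz\<close> is not used.\<close>

definition loc_lipschitz_on :: "'s::metric_space set \<Rightarrow> ('s \<Rightarrow> 't::metric_space) \<Rightarrow> bool" where
  "loc_lipschitz_on X h \<longleftrightarrow> local_lipschitz (UNIV :: real set) X (\<lambda>_. h)"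

definition loc_lipschitz_C1 ::
    "('s::real_normed_vector \<Rightarrow> 't::real_normed_vector) \<Rightarrow> bool" where
  "loc_lipschitz_C1 M \<longleftrightarrow> (\<exists>M' :: 's \<Rightarrow> 's \<Rightarrow>\<^sub>L 't.
     (\<forall>x. (M has_derivative blinfun_apply (M' x)) (at x)) \<and>
     continuous_on UNIV M' \<and> loc_lipschitz_on UNIV M')"

definition lie ::
    "(real ^ 'n::finite \<Rightarrow> real ^ 'n) \<Rightarrow> (real ^ 'n \<Rightarrow> real ^ 'p::finite ^ 'p)
      \<Rightarrow> real ^ 'n \<Rightarrow> real ^ 'p ^ 'p" where
  "lie X M x = (\<chi> i j. frechet_derivative (\<lambda>y. M y $ i $ j) (at x) (X x))"

definition lie_input ::
    "(real ^ 'n::finite \<Rightarrow> real ^ 'm::finite ^ 'n) \<Rightarrow> (real ^ 'n \<Rightarrow> real ^ 'p::finite ^ 'p)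
      \<Rightarrow> real ^ 'n \<Rightarrow> real ^ 'm \<Rightarrow> real ^ 'p ^ 'p" where
  "lie_input G M x u = (\<Sum>l\<in>UNIV. u $ l *\<^sub>R lie (\<lambda>y. column l (G y)) M x)"

definition lie_agent ::
    "('m::finite \<Rightarrow> 'a) \<Rightarrow> (real ^ 'n::finite \<Rightarrow> real ^ 'm ^ 'n) \<Rightarrow> 'a
      \<Rightarrow> (real ^ 'n \<Rightarrow> real ^ 'p::finite ^ 'p) \<Rightarrow> real ^ 'n \<Rightarrow> real ^ 'm \<Rightarrow> real ^ 'p ^ 'p" where
  "lie_agent su G i M x u = (\<Sum>l | su l = i. u $ l *\<^sub>R lie (\<lambda>y. column l (G y)) M x)"

text \<open>
  Only the members before the relative degree is reached are used; for these the input part of the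
  time derivative vanishes, so the time derivative is the Lie derivative along \<open>F\<close>.
\<close>

primrec Psi ::
    "(real ^ 'n::finite \<Rightarrow> real ^ 'n) \<Rightarrow> (real ^ 'n \<Rightarrow> real ^ 'p::finite ^ 'p) \<Rightarrow> (nat \<Rightarrow> real)
      \<Rightarrow> nat \<Rightarrow> real ^ 'n \<Rightarrow> real ^ 'p ^ 'p" where
  "Psi F H c 0 = H"
| "Psi F H c (Suc q) = (\<lambda>x. lie F (Psi F H c q) x + c (Suc q) *\<^sub>R Psi F H c q x)"

text \<open>
  The last member. The normal inputs are a family \<open>w\<close> of vectors \<open>w i \<in> agent_space su i\<close> indexed by
  the agents outside \<open>\<A>\<close>; \<open>umin j x\<close> is the input of the adversarial agent \<open>j\<close>.
\<close>

definition Psi_top ::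
    "('m::finite \<Rightarrow> 'a::finite) \<Rightarrow> 'a set \<Rightarrow> ('a \<Rightarrow> real ^ 'n \<Rightarrow> real ^ 'm)
      \<Rightarrow> (real ^ 'n::finite \<Rightarrow> real ^ 'n) \<Rightarrow> (real ^ 'n \<Rightarrow> real ^ 'm ^ 'n)
      \<Rightarrow> (real ^ 'n \<Rightarrow> real ^ 'p::finite ^ 'p) \<Rightarrow> (nat \<Rightarrow> real) \<Rightarrow> nat
      \<Rightarrow> real ^ 'n \<Rightarrow> ('a \<Rightarrow> real ^ 'm) \<Rightarrow> real ^ 'p ^ 'p" where
  "Psi_top su \<A> umin F G H c r x w =
     lie F (Psi F H c (r - 1)) x
     + (\<Sum>i\<in>- \<A>. lie_agent su G i (Psi F H c (r - 1)) x (w i))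
     + (\<Sum>j\<in>\<A>. lie_agent su G j (Psi F H c (r - 1)) x (umin j x))
     + c r *\<^sub>R Psi F H c (r - 1) x"

text \<open>
  \<open>r\<close> is the relative degree, and both the normal and the adversarial inputs enter at level \<open>r\<close>
  (their coefficients do not vanish identically).
\<close>

definition relative_degree ::
    "('m::finite \<Rightarrow> 'a::finite) \<Rightarrow> 'a set
      \<Rightarrow> (real ^ 'n::finite \<Rightarrow> real ^ 'n) \<Rightarrow> (real ^ 'n \<Rightarrow> real ^ 'm ^ 'n)
      \<Rightarrow> (real ^ 'n \<Rightarrow> real ^ 'p::finite ^ 'p) \<Rightarrow> (nat \<Rightarrow> real) \<Rightarrow> nat \<Rightarrow> bool" where
  "relative_degree su \<A> F G H c r \<longleftrightarrow>
     1 \<le> r \<and>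
     (\<forall>q x u. q + 2 \<le> r \<longrightarrow> lie_input G (Psi F H c q) x u = 0) \<and>
     (\<exists>i\<in>- \<A>. \<exists>x u. lie_agent su G i (Psi F H c (r - 1)) x u \<noteq> 0) \<and>
     (\<exists>j\<in>\<A>. \<exists>x u. lie_agent su G j (Psi F H c (r - 1)) x u \<noteq> 0)"

definition safe_inputs ::
    "('m::finite \<Rightarrow> 'a::finite) \<Rightarrow> 'a set \<Rightarrow> ('a \<Rightarrow> (real ^ 'm) set) \<Rightarrow> ('a \<Rightarrow> real ^ 'n \<Rightarrow> real ^ 'm)
      \<Rightarrow> (real ^ 'n::finite \<Rightarrow> real ^ 'n) \<Rightarrow> (real ^ 'n \<Rightarrow> real ^ 'm ^ 'n)
      \<Rightarrow> (real ^ 'n \<Rightarrow> real ^ 'p::finite ^ 'p) \<Rightarrow> (nat \<Rightarrow> real) \<Rightarrow> nat \<Rightarrow> real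
      \<Rightarrow> real ^ 'n \<Rightarrow> ('a \<Rightarrow> real ^ 'm) set" where
  "safe_inputs su \<A> U umin F G H c r \<delta> x =
     {w \<in> Pi\<^sub>E (- \<A>) U. \<delta> *\<^sub>R mat 1 \<preceq>\<^sub>L Psi_top su \<A> umin F G H c r x w}"

definition high_order_ARZE_MCBF ::
    "('m::finite \<Rightarrow> 'a::finite) \<Rightarrow> 'a set \<Rightarrow> ('a \<Rightarrow> (real ^ 'm) set) \<Rightarrow> ('a \<Rightarrow> real ^ 'n \<Rightarrow> real ^ 'm)
      \<Rightarrow> (real ^ 'n::finite \<Rightarrow> real ^ 'n) \<Rightarrow> (real ^ 'n \<Rightarrow> real ^ 'm ^ 'n)
      \<Rightarrow> (real ^ 'n \<Rightarrow> real ^ 'p::finite ^ 'p) \<Rightarrow> (nat \<Rightarrow> real) \<Rightarrow> nat \<Rightarrow> real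
      \<Rightarrow> (real ^ 'n) set \<Rightarrow> bool" where
  "high_order_ARZE_MCBF su \<A> U umin F G H c r \<delta> D \<longleftrightarrow>
     (\<forall>q\<in>{1..r}. 0 < c q) \<and> cont_diff r H \<and>
     (\<forall>x\<in>D. \<exists>w \<in> Pi\<^sub>E (- \<A>) U. \<delta> *\<^sub>R mat 1 \<preceq>\<^sub>L Psi_top su \<A> umin F G H c r x w)"

definition sample_time :: "real \<Rightarrow> real \<Rightarrow> nat \<Rightarrow> real" where
  "sample_time t0 \<Delta>t k = t0 + real k * \<Delta>t"

text \<open>
  Trajectories on \<open>[t0, T)\<close>, where \<open>T = \<infinity>\<close> is allowed, of the closed loop in which the normal
  agents use \<open>\<kappa>\<close> and the adversarial ones \<open>umin\<close>, both sampled and held. The trajectory is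
  continuous; at a sampling time the derivative is the one from the right.
\<close>

definition closed_loop_trajectory ::
    "('m::finite \<Rightarrow> 'a) \<Rightarrow> 'a set \<Rightarrow> ('a \<Rightarrow> real ^ 'n \<Rightarrow> real ^ 'm)
      \<Rightarrow> (real ^ 'n::finite \<Rightarrow> real ^ 'n) \<Rightarrow> (real ^ 'n \<Rightarrow> real ^ 'm ^ 'n) \<Rightarrow> real \<Rightarrow> real
      \<Rightarrow> (real ^ 'n \<Rightarrow> 'a \<Rightarrow> real ^ 'm) \<Rightarrow> ereal \<Rightarrow> (real \<Rightarrow> real ^ 'n) \<Rightarrow> bool" where
  "closed_loop_trajectory su \<A> umin F G t0 \<Delta>t \<kappa> T x \<longleftrightarrow>
     ereal t0 < T \<and>
     continuous_on {t. t0 \<le> t \<and> ereal t < T} x \<and>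
     (\<forall>k t. sample_time t0 \<Delta>t k \<le> t \<and> t < sample_time t0 \<Delta>t (Suc k) \<and> ereal t < T \<longrightarrow>
        (x has_vector_derivative
           F (x t) + G (x t) *v stack su (\<lambda>i. if i \<in> \<A> then umin i (x (sample_time t0 \<Delta>t k))
                                             else \<kappa> (x (sample_time t0 \<Delta>t k)) i))
          (at t within {sample_time t0 \<Delta>t k ..< sample_time t0 \<Delta>t (Suc k)}))"

text \<open>
  Trajectories that exist only up to a finite \<open>T\<close> are included, so that invariance is not vacuous
  for trajectories without a global continuation.
\<close>

definition forward_invariant ::
    "real \<Rightarrow> (ereal \<Rightarrow> (real \<Rightarrow> 's) \<Rightarrow> bool) \<Rightarrow> 's set \<Rightarrow> bool" where
  "forward_invariant t0 traj C \<longleftrightarrow>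
     (\<forall>T x. traj T x \<and> x t0 \<in> C \<longrightarrow> (\<forall>t. t0 \<le> t \<and> ereal t < T \<longrightarrow> x t \<in> C))"

end

theory Submission
  imports Defs
begin

text \<open>
  Put \<open>\<psi> = \<Psi>\<^bsub>r - 1\<^esub>\<close>. Since \<open>\<Psi>\<^sub>q' + c \<Psi>\<^sub>q = \<Psi>\<^bsub>q + 1\<^esub>\<close> for \<open>q < r - 1\<close>, it suffices to keep \<open>\<psi>\<close> positive
  semidefinite beyond the first exit time, and for this it is enough that
  \<open>\<sigma> = e \<bullet> \<psi> e\<close> has positive rate \<open>R\<close> whenever it vanishes for a unit vector \<open>e\<close>.

  The margin \<open>\<delta>\<close> contains \<open>L_H\<close>, which is a Lipschitz constant of \<open>\<psi>\<close> only for \<open>r = 1\<close>; in this case the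
  bound on \<open>R + c \<sigma>\<close> at the sampling time carries over to the whole sampling interval. For \<open>r \<ge> 2\<close>
  another argument is used, which needs no Lipschitz bound on \<open>\<psi>\<close>. Let \<open>M\<close> be the Lipschitz constant in the state of
  \<open>R\<close> and \<open>V\<close> the speed bound, so that \<open>\<delta> \<ge> \<Delta>t M V\<close>. As the level sets of \<open>H\<close> are tangent to the input
  directions, almost minimising \<open>\<sigma> + (M / c) dist x1\<close> on the level set of \<open>H\<close> through a zero \<open>x1\<close> of
  \<open>\<sigma>\<close> gives a safe point at which the inputs change \<open>\<sigma>\<close> at rate at most \<open>M V / c\<close>, and feasibility there
  shows that \<open>R \<ge> \<delta> - 2 M V / c\<close> at \<open>x1\<close> for every admissible input. Integrating \<open>R\<close> from the sampling
  time, where \<open>R \<ge> \<delta> - c \<sigma>\<close>, to the crossing time then excludes \<open>R \<le> 0\<close> at the crossing.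
\<close>

section \<open>Norms, the Loewner order and Lie derivatives\<close>

lemma spectral_norm_nonneg: "0 \<le> spectral_norm A"
  unfolding spectral_norm_def by (simp add: onorm_pos_le)

lemma norm_matrix_vector_le_spectral: "norm (A *v v) \<le> spectral_norm A * norm v"
  unfolding spectral_norm_def by (simp add: onorm)

lemma spectral_norm_triangle: "spectral_norm (A + B) \<le> spectral_norm A + spectral_norm B"
proof -
  have "(*v) (A + B) = (\<lambda>v. A *v v + B *v v)"
    by (simp add: fun_eq_iff matrix_vector_mult_add_rdistrib)
  then show ?thesis
    by (simp add: spectral_norm_def onorm_triangle)
qed

lemma spectral_norm_scaleR: "spectral_norm (a *\<^sub>R A) = \<bar>a\<bar> * spectral_norm A"
proof -
  have "(*v) (a *\<^sub>R A) = (\<lambda>v. a *\<^sub>R (A *v v))"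
    by (simp add: fun_eq_iff scaleR_matrix_vector_assoc)
  then show ?thesis
    by (simp add: spectral_norm_def onorm_scaleR)
qed

lemma spectral_norm_zero [simp]: "spectral_norm 0 = 0"
  using spectral_norm_scaleR[of 0 "0 :: real ^ 'a ^ 'b"] by simp

lemma spectral_norm_sum: "spectral_norm (\<Sum>l\<in>I. A l) \<le> (\<Sum>l\<in>I. spectral_norm (A l))"
proof (cases "finite I")
  case True
  then show ?thesis
  proof induction
    case empty
    show ?case by simp
  next
    case (insert i I)
    then show ?case
      using spectral_norm_triangle[of "A i" "\<Sum>l\<in>I. A l"] by simp
  qed
qed simp

lemma spectral_norm_zero_iff: "spectral_norm A = 0 \<longleftrightarrow> A = 0"
proof
  assume "spectral_norm A = 0"
  then have "A *v v = 0" for v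
    using norm_matrix_vector_le_spectral[of A v] by simp
  then show "A = 0"
    by (simp add: matrix_eq)
qed simp

text \<open>The real supremum in \<open>ind_norm\<close> is informative only for a set bounded
  above; linearity provides the bound through the images of the basis vectors.\<close>

lemma ind_norm_bound:
  fixes T :: "real ^ 'm \<Rightarrow> real ^ 'q ^ 'p"
  assumes "linear T"
  shows "spectral_norm (T u) \<le> ind_norm T * norm u"
proof (cases "u = 0")
  case True
  then show ?thesis
    using linear_0[OF assms] by simp
next
  case False
  define C where "C = (\<Sum>l\<in>UNIV. spectral_norm (T (axis l 1)))"
  have C: "spectral_norm (T v) \<le> C * norm v" for v
  proof -
    have "T v = (\<Sum>l\<in>UNIV. v $ l *\<^sub>R T (axis l 1))"
      using arg_cong[OF basis_expansion[of v], of T]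
      by (simp add: linear_sum[OF assms] linear_scale[OF assms] scalar_mult_eq_scaleR)
    then have "spectral_norm (T v) \<le> (\<Sum>l\<in>UNIV. \<bar>v $ l\<bar> * spectral_norm (T (axis l 1)))"
      using spectral_norm_sum[of "\<lambda>l. v $ l *\<^sub>R T (axis l 1)" UNIV]
      by (simp add: spectral_norm_scaleR)
    also have "\<dots> \<le> (\<Sum>l\<in>UNIV. norm v * spectral_norm (T (axis l 1)))"
      by (intro sum_mono mult_right_mono component_le_norm_cart spectral_norm_nonneg)
    finally show ?thesis
      by (simp add: C_def sum_distrib_left mult.commute)
  qed
  \<comment> \<open>At zero the quotient has the default value 0, so the bound \<open>C\<close> must
    also be nonnegative.\<close>
  have "bdd_above (range (\<lambda>u. spectral_norm (T u) / norm u))"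
  proof (rule bdd_aboveI2)
    fix v :: "real ^ 'm"
    show "spectral_norm (T v) / norm v \<le> C"
      using C[of v]
      by (cases "v = 0") (auto simp: divide_simps C_def intro!: sum_nonneg spectral_norm_nonneg)
  qed
  then have "spectral_norm (T u) / norm u \<le> ind_norm T"
    unfolding ind_norm_def by (intro cSUP_upper) auto
  then show ?thesis
    using False by (simp add: divide_simps)
qed

section \<open>Quadratic forms and the positive semidefinite cone\<close>

lemma abs_quadratic_form_le:
  assumes "norm e = 1"
  shows "\<bar>e \<bullet> (A *v e)\<bar> \<le> spectral_norm A"
  using Cauchy_Schwarz_ineq2[of e "A *v e"] norm_matrix_vector_le_spectral[of A e] assms by simp

lemma bounded_linear_quadratic_form: "bounded_linear (\<lambda>A :: real ^ 'p ^ 'p. e \<bullet> (A *v e))"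
  by (rule linear_conv_bounded_linear[THEN iffD1], rule linearI)
    (simp_all add: matrix_vector_mult_add_rdistrib inner_add_right scaleR_matrix_vector_assoc[symmetric])

lemma psd_normI:
  fixes A :: "real ^ 'p ^ 'p"
  assumes "transpose A = A" "\<And>e. norm e = 1 \<Longrightarrow> 0 \<le> e \<bullet> (A *v e)"
  shows "psd A"
  unfolding psd_def
proof (intro conjI allI assms(1))
  fix v :: "real ^ 'p"
  show "0 \<le> v \<bullet> (A *v v)"
  proof (cases "v = 0")
    case False
    define e where "e = v /\<^sub>R norm v"
    have "norm e = 1" "v = norm v *\<^sub>R e"
      using False by (auto simp: e_def)
    then have "v \<bullet> (A *v v) = (norm v * norm v) * (e \<bullet> (A *v e))"
      by (metis (no_types) inner_scaleR_left inner_scaleR_right matrix_vector_mult_scaleR mult.assoc)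
    then show ?thesis
      using assms(2)[OF \<open>norm e = 1\<close>] by simp
  qed simp
qed

text \<open>An intersection of closed conditions, one for each vector besides symmetry. It makes
  \<open>S_Q\<close> closed and enters the exclusion of \<open>L_H = 0\<close>.\<close>

lemma closed_psd: "closed {A :: real ^ 'p ^ 'p. psd A}"
proof -
  have "continuous_on UNIV (\<lambda>A :: real ^ 'p ^ 'p. transpose A)"
    unfolding transpose_def by (intro continuous_intros)
  then have "closed {A :: real ^ 'p ^ 'p. transpose A = A}"
    by (intro closed_Collect_eq continuous_on_id)
  moreover have "closed {A :: real ^ 'p ^ 'p. \<forall>v. 0 \<le> v \<bullet> (A *v v)}"
    by (intro closed_Collect_all closed_Collect_le continuous_on_const
        linear_continuous_on bounded_linear_quadratic_form)
  ultimately show ?thesis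
    by (auto simp: psd_def Collect_conj_eq)
qed

section \<open>Lie derivatives, the \<open>Psi\<close> sequence and stacked inputs\<close>

lemma lie_eq_derivative:
  fixes M :: "real ^ 'n \<Rightarrow> real ^ 'p ^ 'p"
  assumes "(M has_derivative M') (at x)"
  shows "lie X M x = M' (X x)"
proof -
  have "((\<lambda>y. M y $ i $ j) has_derivative (\<lambda>v. M' v $ i $ j)) (at x)" for i j
    by (intro bounded_linear.has_derivative[OF bounded_linear_vec_nth] assms)
  then have "frechet_derivative (\<lambda>y. M y $ i $ j) (at x) = (\<lambda>v. M' v $ i $ j)" for i j
    using frechet_derivative_at by metis
  then show ?thesis
    by (simp add: lie_def vec_eq_iff)
qed

lemma lie_input_eq_derivative:
  fixes M :: "real ^ 'n \<Rightarrow> real ^ 'p ^ 'p" and G :: "real ^ 'n \<Rightarrow> real ^ 'm ^ 'n"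
  assumes "(M has_derivative M') (at x)"
  shows "lie_input G M x u = M' (G x *v u)"
proof -
  have "linear M'"
    using assms has_derivative_linear by blast
  then show ?thesis
    by (simp add: lie_input_def lie_eq_derivative[OF assms] matrix_mult_sum linear_sum linear_scale
        scalar_mult_eq_scaleR)
qed

lemma lie_const: "lie X (\<lambda>_. C) x = 0"
  by (simp add: lie_def vec_eq_iff)

lemma linear_lie_input: "linear (lie_input G M x)"
  by (rule linearI) (simp_all add: lie_input_def scaleR_add_left sum.distrib scaleR_sum_right)

text \<open>The owner map \<open>su\<close> partitions the columns of \<open>G\<close>, so the sum
  over columns can be grouped by agent.\<close>

lemma lie_input_stack:
  fixes su :: "'m::finite \<Rightarrow> 'a::finite"
  shows
  "lie_input G M x (stack su w) = (\<Sum>i\<in>UNIV. lie_agent su G i M x (w i))"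
proof -
  have "(\<Sum>i\<in>UNIV. lie_agent su G i M x (w i))
      = (\<Sum>i\<in>UNIV. \<Sum>l | l \<in> UNIV \<and> su l = i. stack su w $ l *\<^sub>R lie (\<lambda>y. column l (G y)) M x)"
    unfolding lie_agent_def stack_def by (intro sum.cong) auto
  also have "\<dots> = lie_input G M x (stack su w)"
    unfolding lie_input_def by (rule sum.group) auto
  finally show ?thesis by simp
qed

text \<open>Since \<open>psd\<close> includes symmetry, the whole sequence has to stay symmetric;
  the entrywise Lie derivative commutes with transposition.\<close>

lemma transpose_Psi:
  assumes "\<And>x. transpose (H x) = H x"
  shows "transpose (Psi F H c q x) = Psi F H c q x"
proof (induction q arbitrary: x)
  case 0
  show ?case by (simp add: assms)
next
  case (Suc q)
  have sym: "Psi F H c q y $ i $ j = Psi F H c q y $ j $ i" for y i j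
    using arg_cong[OF Suc[of y], of "\<lambda>A. A $ j $ i"] by (simp add: transpose_def)
  have "lie F (Psi F H c q) x $ i $ j = lie F (Psi F H c q) x $ j $ i" for i j
    by (simp only: lie_def vec_lambda_beta sym[of _ i j])
  then have "transpose (lie F (Psi F H c q) x) = lie F (Psi F H c q) x"
    by (simp only: transpose_def vec_eq_iff vec_lambda_beta) blast
  with Suc[of x] show ?case
    by (simp add: transpose_def vec_eq_iff)
qed

text \<open>Serves the degenerate case of a constant \<open>H\<close>, in which no input can appear
  at any level.\<close>

lemma Psi_const: "\<exists>C. Psi F (\<lambda>_. C0) c q = (\<lambda>_. C)"
  by (induction q) (auto simp: lie_const)

text \<open>Compactness of every \<open>U i\<close> bounds the norms on
  \<open>input_set su U\<close>, which makes the real supremum an upper bound.\<close>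

lemma norm_stack_le_SUP:
  fixes su :: "'m::finite \<Rightarrow> 'a::finite"
  assumes space: "\<And>i. U i \<subseteq> agent_space su i" and cpt: "\<And>i. compact (U i)"
    and w: "\<And>i. w i \<in> U i"
  shows "norm (stack su w) \<le> (SUP u\<in>input_set su U. norm u)"
proof -
  \<comment> \<open>\<open>w i\<close> is supported on the coordinates of agent \<open>i\<close>, so
    nothing is lost by stacking.\<close>
  have "block su i (stack su w) = w i" for i
    using space[of i] w[of i] by (auto simp: block_def stack_def agent_space_def vec_eq_iff)
  then have "stack su w \<in> input_set su U"
    using w by (simp add: input_set_def)
  moreover have "bdd_above (norm ` input_set su U)"
  proof -
    have "\<exists>C. \<forall>v\<in>U i. norm v \<le> C" for i
      using compact_imp_bounded[OF cpt] by (auto simp: bounded_iff)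
    then obtain C where C: "\<And>i v. v \<in> U i \<Longrightarrow> norm v \<le> C i"
      by metis
    have "norm u \<le> (\<Sum>l\<in>UNIV. C (su l))" if "u \<in> input_set su U" for u
    proof -
      have "\<bar>u $ l\<bar> \<le> C (su l)" for l
      proof -
        have "\<bar>u $ l\<bar> = \<bar>block su (su l) u $ l\<bar>"
          by (simp add: block_def)
        also have "\<dots> \<le> norm (block su (su l) u)"
          by (rule component_le_norm_cart)
        also have "\<dots> \<le> C (su l)"
          using that by (intro C) (simp add: input_set_def)
        finally show ?thesis .
      qed
      then show ?thesis
        using norm_le_l1_cart[of u] sum_mono[of UNIV "\<lambda>l. \<bar>u $ l\<bar>" "\<lambda>l. C (su l)"] by simp
    qed
    then show ?thesis
      by (intro bdd_aboveI2)
  qed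
  ultimately show ?thesis
    by (intro cSUP_upper)
qed

section \<open>The rate at a crossing time\<close>

lemma nondecreasing_from_derivative:
  fixes f :: "real \<Rightarrow> real"
  assumes "a \<le> b" "continuous_on {a..b} f"
    and "\<And>t. a < t \<Longrightarrow> t < b \<Longrightarrow> (f has_real_derivative f' t) (at t)"
    and "\<And>t. a < t \<Longrightarrow> t < b \<Longrightarrow> 0 \<le> f' t"
  shows "f a \<le> f b"
  by (rule DERIV_nonneg_imp_increasing_open[OF assms(1)]) (use assms in blast)+

text \<open>If \<open>R b \<le> 0\<close>, the Lipschitz bound on the rate keeps
  \<open>\<sigma>\<close> above a parabola issued from \<open>a\<close> and below one issued from
  \<open>b\<close>. The two are incompatible; the natural time scale is
  \<open>1 / c\<close>.\<close>

lemma crossing_rate_pos: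
  fixes \<sigma> R :: "real \<Rightarrow> real"
  assumes ab: "a \<le> b" "b < a + \<Delta>" and c: "0 < c" and m: "0 \<le> m" and \<delta>: "0 < \<delta>" "\<Delta> * m \<le> \<delta>"
    and cont: "continuous_on {a..b} \<sigma>"
    and deriv: "\<And>t. a < t \<Longrightarrow> t < b \<Longrightarrow> (\<sigma> has_real_derivative R t) (at t)"
    and R_lip: "\<And>s t. a \<le> s \<Longrightarrow> s \<le> t \<Longrightarrow> t \<le> b \<Longrightarrow> \<bar>R t - R s\<bar> \<le> m * (t - s)"
    and start: "0 \<le> \<sigma> a" "\<delta> \<le> R a + c * \<sigma> a"
    and crossing: "\<sigma> b = 0" "\<delta> - 2 * m / c \<le> R b"
  shows "0 < R b"
proof (rule ccontr)
  assume "\<not> 0 < R b"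
  then have Rb: "R b \<le> 0" by simp
  \<comment> \<open>Over this length the unknown \<open>\<sigma> a\<close> cancels:
    \<open>\<sigma> a + X * R a \<ge> X * \<delta>\<close>.\<close>
  define X where "X = 1 / c"
  have X: "0 < X" "c * X = 1"
    using c by (auto simp: X_def)
  \<comment> \<open>Integration of \<open>R s \<ge> R a - m * (s - a)\<close> from
    \<open>a\<close>.\<close>
  have early: "\<sigma> a + (t - a) * R a - m * (t - a)\<^sup>2 / 2 \<le> \<sigma> t" if t: "a \<le> t" "t \<le> b" for t
  proof -
    let ?f = "\<lambda>s. \<sigma> s - (s - a) * R a + m * (s - a)\<^sup>2 / 2"
    have "continuous_on {a..t} ?f"
      using t by (intro continuous_intros continuous_on_subset[OF cont]) auto
    moreover have "(?f has_real_derivative R s - R a + m * (s - a)) (at s)"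
      if "a < s" "s < t" for s
      using that t by (auto intro!: derivative_eq_intros deriv)
    moreover have "0 \<le> R s - R a + m * (s - a)" if "a < s" "s < t" for s
      using R_lip[of a s] that t by auto
    ultimately have "?f a \<le> ?f t"
      using t(1) by (intro nondecreasing_from_derivative[of a t ?f "\<lambda>s. R s - R a + m * (s - a)"])
    then show ?thesis by simp
  qed
  \<comment> \<open>Integration of \<open>R s \<ge> R b - m * (b - s)\<close> up to
    \<open>b\<close>.\<close>
  have late: "\<sigma> t \<le> \<sigma> b - (b - t) * R b + m * (b - t)\<^sup>2 / 2" if t: "a \<le> t" "t \<le> b" for t
  proof -
    let ?f = "\<lambda>s. \<sigma> s + (b - s) * R b - m * (b - s)\<^sup>2 / 2"
    have "continuous_on {t..b} ?f"
      using t by (intro continuous_intros continuous_on_subset[OF cont]) auto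
    moreover have "(?f has_real_derivative R s - R b + m * (b - s)) (at s)"
      if "t < s" "s < b" for s
      using that t by (auto intro!: derivative_eq_intros deriv simp: field_simps)
    moreover have "0 \<le> R s - R b + m * (b - s)" if "t < s" "s < b" for s
      using R_lip[of s b] that t by auto
    ultimately have "?f t \<le> ?f b"
      using t(2) by (intro nondecreasing_from_derivative[of t b ?f "\<lambda>s. R s - R b + m * (b - s)"])
    then show ?thesis by simp
  qed
  show False
  proof (cases "b - a \<le> X")
    case True
    \<comment> \<open>Short interval: \<open>\<sigma> a\<close> enters with the nonnegative factor
      \<open>1 - c * h\<close>, and the quadratic loss is at most half of the gain
      \<open>h * \<delta>\<close>, so \<open>\<sigma> b\<close> would be positive.\<close>
    define h where "h = b - a"
    have h: "0 \<le> h" "h \<le> \<Delta>" "h \<le> X" using ab True by (auto simp: h_def)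
    have "h \<noteq> 0"
      using start(2) crossing(1) \<delta>(1) Rb by (auto simp: h_def)
    have "\<sigma> a + h * R a \<le> h * (h * m) / 2"
      using early[of b] ab crossing(1) by (simp add: h_def power2_eq_square mult_ac)
    moreover have "h * (\<delta> - c * \<sigma> a) \<le> h * R a"
      using start(2) h by (intro mult_left_mono) auto
    moreover have "h * (h * m) \<le> h * \<delta>"
      using mult_right_mono[OF h(2) m] \<delta>(2) h(1) by (intro mult_left_mono) auto
    moreover have "0 \<le> \<sigma> a * (1 - c * h)"
      using start(1) mult_left_mono[OF h(3), of c] X c by (intro mult_nonneg_nonneg) auto
    moreover have "0 < h * \<delta>"
      using \<open>h \<noteq> 0\<close> h \<delta> by simp
    ultimately show False
      by (simp add: algebra_simps)
  next
    case False
    \<comment> \<open>Long interval: the parabolas are compared at \<open>a + X\<close>. They give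
      \<open>(X + Y) * \<delta> \<le> m * X\<^sup>2 / 2 + m * Y\<^sup>2 / 2 + 2 * m * X * Y\<close>,
      while \<open>\<Delta> * m \<le> \<delta>\<close> makes the left side at least
      \<open>m * (X + Y)\<^sup>2\<close>. The factor 2 in \<open>crossing\<close> matches the mixed
      term.\<close>
    define Y where "Y = b - (a + X)"
    have Y: "0 < Y" "X + Y \<le> \<Delta>" using False ab by (auto simp: Y_def)
    have Rb_ge: "\<delta> - 2 * m * X \<le> R b"
      using crossing(2) by (simp add: X_def)
    then have "0 < m * X"
      using Rb \<delta>(1) by linarith
    then have "0 < m"
      using X by (simp add: zero_less_mult_iff)
    have "X * (c * \<sigma> a) = \<sigma> a"
      using X(2) by (metis mult.assoc mult.commute mult_1)
    then have "X * \<delta> - \<sigma> a \<le> X * R a"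
      using mult_left_mono[OF start(2), of X] X(1) unfolding distrib_left by linarith
    moreover have "\<sigma> a + X * R a - m * X\<^sup>2 / 2 \<le> - (Y * R b) + m * Y\<^sup>2 / 2"
      using early[of "a + X"] late[of "a + X"] X Y crossing(1) by (simp add: Y_def)
    moreover have "Y * (\<delta> - 2 * m * X) \<le> Y * R b"
      using Rb_ge Y by (intro mult_left_mono) auto
    moreover have "(X + Y) * (m * (X + Y)) \<le> (X + Y) * \<delta>"
      using mult_right_mono[OF Y(2) m] \<delta>(2) X Y by (intro mult_left_mono) (auto simp: mult.commute)
    moreover have "0 < m * X\<^sup>2" "0 < m * Y\<^sup>2"
      using \<open>0 < m\<close> X Y by auto
    ultimately show False
      by (simp add: algebra_simps power2_eq_square)
  qed
qed

text \<open>Minimise \<open>\<sigma> z + \<kappa> * norm (z - x1) + N * (norm (H z - H x1))\<^sup>2\<close> over a ball. The penalty has zero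
  derivative in the directions \<open>G z u\<close>, so its weight does not enter the first-order condition.\<close>

lemma stationary_point_on_level_set:
  fixes \<sigma> :: "'x::euclidean_space \<Rightarrow> real" and H :: "'x \<Rightarrow> 'h::euclidean_space" and G :: "'x \<Rightarrow> 'u \<Rightarrow> 'x"
  assumes "open D" and x1_D: "{z. H z = H x1} \<subseteq> D"
    and \<sigma>': "\<And>z. (\<sigma> has_derivative \<sigma>' z) (at z)"
    and H': "\<And>z. (H has_derivative H' z) (at z)"
    and HG: "\<And>z u. H' z (G z u) = 0"
    and g: "\<And>z u. z \<in> D \<Longrightarrow> u \<in> U \<Longrightarrow> norm (G z u) \<le> g"
    and \<kappa>: "0 < \<kappa>"
    and cont: "\<And>u. u \<in> U \<Longrightarrow> continuous_on D (\<lambda>z. \<sigma>' z (G z u))"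
    and x1: "\<sigma> x1 = 0"
    and coercive: "\<And>z. H z = H x1 \<Longrightarrow> \<sigma> z + \<kappa> * norm (z - x1) \<le> 0 \<Longrightarrow> norm (z - x1) < \<rho>"
  obtains z where "H z = H x1" "\<sigma> z + \<kappa> * norm (z - x1) \<le> 0"
    "\<And>u. u \<in> U \<Longrightarrow> \<bar>\<sigma>' z (G z u)\<bar> \<le> \<kappa> * g"
proof -
  have \<sigma>_cont: "continuous_on X \<sigma>" for X
    by (meson \<sigma>' continuous_at_imp_continuous_on has_derivative_continuous)
  have H_cont: "continuous_on X H" for X
    by (meson H' continuous_at_imp_continuous_on has_derivative_continuous)
  \<comment> \<open>At \<open>x1\<close> itself the coercivity hypothesis reads
    \<open>0 < \<rho>\<close>.\<close>
  have \<rho>: "0 < \<rho>"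
    using coercive[of x1] x1 by auto
  let ?K = "cball x1 \<rho>"
  define \<Phi> where "\<Phi> N z = \<sigma> z + \<kappa> * norm (z - x1) + real N * (norm (H z - H x1))\<^sup>2" for N z
  have "\<exists>z\<in>?K. \<forall>y\<in>?K. \<Phi> N z \<le> \<Phi> N y" for N
    unfolding \<Phi>_def using \<rho>
    by (intro continuous_attains_inf continuous_intros \<sigma>_cont H_cont) auto
  then obtain Z where Z: "\<And>N. Z N \<in> ?K" "\<And>N y. y \<in> ?K \<Longrightarrow> \<Phi> N (Z N) \<le> \<Phi> N y"
    by metis
  \<comment> \<open>Comparison with \<open>x1\<close>, where all three terms vanish.\<close>
  have \<Phi>_Z: "\<Phi> N (Z N) \<le> 0" for N
    using Z(2)[of x1 N] \<rho> by (simp add: \<Phi>_def x1)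
  obtain z s where z: "z \<in> ?K" "strict_mono s" "(Z \<circ> s) \<longlonglongrightarrow> z"
    using compact_cball[of x1 \<rho>] Z(1) unfolding compact_def by metis
  have s_top: "filterlim (\<lambda>n. real (s n)) at_top sequentially"
    using filterlim_compose[OF filterlim_real_sequentially filterlim_subseq[OF z(2)]] .
  have lim_\<sigma>: "(\<lambda>n. \<sigma> (Z (s n))) \<longlonglongrightarrow> \<sigma> z"
    using continuous_on_tendsto_compose[OF \<sigma>_cont[of UNIV] z(3)] by (simp add: o_def)
  have lim_H: "(\<lambda>n. H (Z (s n))) \<longlonglongrightarrow> H z"
    using continuous_on_tendsto_compose[OF H_cont[of UNIV] z(3)] by (simp add: o_def)
  have lim_\<sigma>\<kappa>: "(\<lambda>n. \<sigma> (Z (s n)) + \<kappa> * norm (Z (s n) - x1)) \<longlonglongrightarrow> \<sigma> z + \<kappa> * norm (z - x1)"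
    using z(3) by (intro tendsto_intros lim_\<sigma>) (simp add: o_def)
  have le0: "\<sigma> (Z n) + \<kappa> * norm (Z n - x1) \<le> 0" for n
    using \<Phi>_Z[of n] zero_le_power2[of "norm (H (Z n) - H x1)"]
    unfolding \<Phi>_def by (smt (verit) of_nat_0_le_iff mult_nonneg_nonneg)
  have z_le: "\<sigma> z + \<kappa> * norm (z - x1) \<le> 0"
    by (rule LIMSEQ_le_const2[OF lim_\<sigma>\<kappa>]) (use le0 in auto)
  \<comment> \<open>The weighted penalty is at most \<open>- \<sigma>\<close> at the minimisers,
    which converges; division by the growing weight forces the limit onto the level set.\<close>
  have Hz: "H z = H x1"
  proof -
    have "(\<lambda>n. (norm (H (Z (s n)) - H x1))\<^sup>2) \<longlonglongrightarrow> 0"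
    proof (rule tendsto_sandwich[OF _ _ tendsto_const])
      have "(\<lambda>n. inverse (real (s n)) * (- \<sigma> (Z (s n)))) \<longlonglongrightarrow> 0 * (- \<sigma> z)"
        by (intro tendsto_intros lim_\<sigma> tendsto_inverse_0_at_top s_top)
      then show "(\<lambda>n. inverse (real (s n)) * (- \<sigma> (Z (s n)))) \<longlonglongrightarrow> 0"
        by simp
      show "\<forall>\<^sub>F n in sequentially. (norm (H (Z (s n)) - H x1))\<^sup>2 \<le> inverse (real (s n)) * (- \<sigma> (Z (s n)))"
        using filterlim_at_top_dense[THEN iffD1, OF s_top, rule_format, of 0]
      proof eventually_elim
        case (elim n)
        have "0 \<le> \<kappa> * norm (Z (s n) - x1)"
          using \<kappa> by simp
        then have "real (s n) * (norm (H (Z (s n)) - H x1))\<^sup>2 \<le> - \<sigma> (Z (s n))"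
          using \<Phi>_Z[of "s n"] unfolding \<Phi>_def by linarith
        then show ?case
          using elim by (simp add: field_simps)
      qed
    qed auto
    moreover have "(\<lambda>n. (norm (H (Z (s n)) - H x1))\<^sup>2) \<longlonglongrightarrow> (norm (H z - H x1))\<^sup>2"
      by (intro tendsto_intros lim_H)
    ultimately have "(norm (H z - H x1))\<^sup>2 = 0"
      using LIMSEQ_unique by blast
    then show ?thesis by simp
  qed
  have zD: "z \<in> D" using x1_D Hz by auto
  \<comment> \<open>Strict coercivity keeps the limit off the boundary, so the selected minimisers
    are eventually interior.\<close>
  have z_ball: "z \<in> ball x1 \<rho>"
    using coercive[OF Hz z_le] by (simp add: dist_norm norm_minus_commute)
  have first_order: "- (\<kappa> * norm v) \<le> \<sigma>' (Z N) v"
    if ZN: "Z N \<in> ball x1 \<rho>" and v: "H' (Z N) v = 0" for N v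
  proof -
    let ?y = "\<lambda>h::real. Z N + h *\<^sub>R v"
    \<comment> \<open>The distance to \<open>x1\<close> is not differentiable at \<open>x1\<close>.
      By the triangle inequality the linear term \<open>\<kappa> * h * norm v\<close> may replace
      its increment for \<open>h > 0\<close>, and minimality bounds the derivative of
      \<open>\<phi>\<close> at 0 from below.\<close>
    define \<phi> where "\<phi> h = \<sigma> (?y h) + real N * (norm (H (?y h) - H x1))\<^sup>2 + \<kappa> * h * norm v" for h
    have y': "(?y has_derivative (\<lambda>h. h *\<^sub>R v)) (at 0)"
      by (auto intro!: derivative_eq_intros)
    have d1: "((\<lambda>h. \<sigma> (?y h)) has_derivative (\<lambda>h. \<sigma>' (Z N) (h *\<^sub>R v))) (at 0)"
      using has_derivative_compose[OF y', of \<sigma> "\<sigma>' (Z N)"] \<sigma>'[of "Z N"] by simp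
    have d2: "((\<lambda>h. H (?y h)) has_derivative (\<lambda>h. H' (Z N) (h *\<^sub>R v))) (at 0)"
      using has_derivative_compose[OF y', of H "H' (Z N)"] H'[of "Z N"] by simp
    have lin: "linear (\<sigma>' (Z N))" "linear (H' (Z N))"
      using \<sigma>' H' has_derivative_linear by blast+
    have "(\<phi> has_derivative (\<lambda>h. h * (\<sigma>' (Z N) v + \<kappa> * norm v))) (at 0)"
      unfolding \<phi>_def power2_norm_eq_inner
      by (rule has_derivative_eq_rhs, (rule derivative_intros d1 d2)+)
        (simp add: linear_scale[OF lin(1)] linear_scale[OF lin(2)] v algebra_simps fun_eq_iff)
    then have \<phi>': "(\<phi> has_real_derivative \<sigma>' (Z N) v + \<kappa> * norm v) (at 0)"
      by (rule has_derivative_imp_has_field_derivative) simp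
    have "\<forall>\<^sub>F h in at 0. ?y h \<in> ball x1 \<rho>"
    proof (rule topological_tendstoD[OF _ open_ball])
      show "(?y \<longlongrightarrow> Z N) (at 0)"
        by (auto intro!: tendsto_eq_intros)
    qed (use ZN in auto)
    then obtain d where d: "d > 0" "\<And>h. h \<noteq> 0 \<Longrightarrow> \<bar>h\<bar> < d \<Longrightarrow> ?y h \<in> ball x1 \<rho>"
      unfolding eventually_at by (auto simp: dist_norm)
    have ge: "\<phi> 0 \<le> \<phi> h" if "0 < h" "h < d" for h
    proof -
      have "\<Phi> N (Z N) \<le> \<Phi> N (?y h)"
        using d(2)[of h] that by (intro Z(2)) auto
      moreover have "norm (?y h - x1) \<le> norm (Z N - x1) + h * norm v"
        using norm_triangle_ineq[of "Z N - x1" "h *\<^sub>R v"] that by (simp add: algebra_simps)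
      then have "\<kappa> * norm (?y h - x1) \<le> \<kappa> * (norm (Z N - x1) + h * norm v)"
        using \<kappa> by (intro mult_left_mono) auto
      ultimately show ?thesis
        unfolding \<Phi>_def \<phi>_def by (simp add: algebra_simps)
    qed
    have "0 \<le> \<sigma>' (Z N) v + \<kappa> * norm v"
    proof (rule ccontr)
      assume "\<not> ?thesis"
      then obtain e where e: "e > 0" "\<And>h. 0 < h \<Longrightarrow> h < e \<Longrightarrow> \<phi> (0 + h) < \<phi> 0"
        using DERIV_neg_dec_right[OF \<phi>'] by auto
      obtain h where "0 < h" "h < min d e"
        using dense[of 0 "min d e"] d(1) e(1) by auto
      then show False
        using ge[of h] e(2)[of h] by simp
    qed
    then show ?thesis by simp
  qed
  have "\<bar>\<sigma>' z (G z u)\<bar> \<le> \<kappa> * g" if u: "u \<in> U" for u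
  proof (rule LIMSEQ_le_const2)
    have "isCont (\<lambda>z. \<sigma>' z (G z u)) z"
      using cont[OF u] zD \<open>open D\<close> continuous_on_eq_continuous_at by blast
    then have "(\<lambda>n. \<sigma>' (Z (s n)) (G (Z (s n)) u)) \<longlonglongrightarrow> \<sigma>' z (G z u)"
      using z(3) isCont_tendsto_compose by (fastforce simp: o_def)
    then show "(\<lambda>n. \<bar>\<sigma>' (Z (s n)) (G (Z (s n)) u)\<bar>) \<longlonglongrightarrow> \<bar>\<sigma>' z (G z u)\<bar>"
      by (rule tendsto_rabs)
    have "\<forall>\<^sub>F n in sequentially. (Z \<circ> s) n \<in> D \<inter> ball x1 \<rho>"
      using zD z_ball \<open>open D\<close> by (intro topological_tendstoD[OF z(3)]) auto
    then have "\<forall>\<^sub>F n in sequentially. \<bar>\<sigma>' (Z (s n)) (G (Z (s n)) u)\<bar> \<le> \<kappa> * g"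
    proof eventually_elim
      case (elim n)
      let ?y = "Z (s n)"
      have lin: "linear (\<sigma>' ?y)" "linear (H' ?y)"
        using \<sigma>' H' has_derivative_linear by blast+
      \<comment> \<open>Both the direction \<open>G ?y u\<close> and its negative are annihilated by
        \<open>H' ?y\<close>, which gives a two-sided bound.\<close>
      have "- (\<kappa> * norm (G ?y u)) \<le> \<sigma>' ?y (G ?y u)"
        using elim HG by (intro first_order) auto
      moreover have "- (\<kappa> * norm (- G ?y u)) \<le> \<sigma>' ?y (- G ?y u)"
        using elim HG linear_neg[OF lin(2)] by (intro first_order) auto
      ultimately have "\<bar>\<sigma>' ?y (G ?y u)\<bar> \<le> \<kappa> * norm (G ?y u)"
        by (simp add: linear_neg[OF lin(1)] abs_le_iff)
      also have "\<dots> \<le> \<kappa> * g"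
        using g u elim \<kappa> by (intro mult_left_mono) auto
      finally show ?case .
    qed
    then show "\<exists>n0. \<forall>n\<ge>n0. \<bar>\<sigma>' (Z (s n)) (G (Z (s n)) u)\<bar> \<le> \<kappa> * g"
      by (simp add: eventually_sequentially)
  qed
  then show thesis
    using that[OF Hz z_le] by blast
qed

text \<open>At the almost minimising point \<open>z\<close> the value \<open>c * \<sigma> z\<close>
  is at most \<open>- (LA + LB) * norm (z - x1)\<close>, which pays for carrying \<open>A\<close>
  and the input term back to \<open>x1\<close>. Replacing the input feasible at \<open>z\<close> by
  \<open>u\<close> costs twice the stationarity bound.\<close>

lemma crossing_rate_lower_bound:
  fixes \<sigma> A :: "'x::euclidean_space \<Rightarrow> real" and H :: "'x \<Rightarrow> 'h::euclidean_space"
    and G :: "'x \<Rightarrow> 'u \<Rightarrow> 'x"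
  assumes "open D" and x1_D: "{z. H z = H x1} \<subseteq> D"
    and \<sigma>': "\<And>z. (\<sigma> has_derivative \<sigma>' z) (at z)"
    and H': "\<And>z. (H has_derivative H' z) (at z)"
    and HG: "\<And>z u. H' z (G z u) = 0"
    and g: "\<And>z u. z \<in> D \<Longrightarrow> u \<in> U \<Longrightarrow> norm (G z u) \<le> g"
    and A_lip: "\<And>y z. y \<in> D \<Longrightarrow> z \<in> D \<Longrightarrow> \<bar>A y - A z\<bar> \<le> LA * norm (y - z)"
    and B_lip: "\<And>y z u. y \<in> D \<Longrightarrow> z \<in> D \<Longrightarrow> u \<in> U \<Longrightarrow>
      \<bar>\<sigma>' y (G y u) - \<sigma>' z (G z u)\<bar> \<le> LB * norm (y - z)"
    and nonneg: "0 < c" "0 \<le> LA" "0 \<le> LB"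
    and feasible: "\<And>z. z \<in> D \<Longrightarrow> \<exists>u\<in>U. \<delta> \<le> A z + \<sigma>' z (G z u) + c * \<sigma> z"
    and bdd: "\<And>u. u \<in> U \<Longrightarrow> \<sigma>' x1 (G x1 u) \<le> C"
    and x1: "\<sigma> x1 = 0"
    and u: "u \<in> U"
  shows "\<delta> - 2 * ((LA + LB) / c) * g \<le> A x1 + \<sigma>' x1 (G x1 u)"
proof -
  let ?B = "\<lambda>z u. \<sigma>' z (G z u)"
  define M where "M = LA + LB"
  have x1D: "x1 \<in> D" using x1_D by auto
  have "0 \<le> g"
    using g[OF x1D u] norm_ge_zero order_trans by blast
  \<comment> \<open>Raising the slope \<open>M / c\<close> by \<open>\<epsilon>\<close> makes the
    minimisation coercive; \<open>\<epsilon>\<close> is removed at the end.\<close>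
  have "\<delta> - 2 * (M / c) * g \<le> A x1 + ?B x1 u + 2 * g * \<epsilon>" if \<epsilon>: "0 < \<epsilon>" for \<epsilon>
  proof -
    define \<kappa> where "\<kappa> = M / c + \<epsilon>"
    have c\<kappa>: "c * \<kappa> = M + c * \<epsilon>"
      using nonneg by (simp add: \<kappa>_def field_simps)
    have \<kappa>: "0 < \<kappa>"
      using nonneg \<epsilon> by (auto simp: \<kappa>_def M_def intro!: add_nonneg_pos)
    \<comment> \<open>Feasibility and the Lipschitz bounds, of total slope \<open>M\<close> against
      \<open>c * \<kappa> = M + c * \<epsilon>\<close>, leave
      \<open>c * \<epsilon> * norm (z - x1) \<le> A x1 + C - \<delta>\<close>. The added 1 makes the
      radius bound strict.\<close>
    define \<rho> where "\<rho> = (\<bar>A x1 + C - \<delta>\<bar> + 1) / (c * \<epsilon>)"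
    have coercive: "norm (z - x1) < \<rho>" if z: "H z = H x1" "\<sigma> z + \<kappa> * norm (z - x1) \<le> 0" for z
    proof -
      have zD: "z \<in> D" using z x1_D by auto
      obtain w where w: "w \<in> U" "\<delta> \<le> A z + ?B z w + c * \<sigma> z"
        using feasible[OF zD] by auto
      have "c * \<sigma> z + (M + c * \<epsilon>) * norm (z - x1) \<le> 0"
        using mult_left_mono[OF z(2), of c] nonneg(1) unfolding c\<kappa>[symmetric]
        by (simp add: algebra_simps)
      moreover have "A z \<le> A x1 + LA * norm (z - x1)" "?B z w \<le> C + LB * norm (z - x1)"
        using A_lip[OF zD x1D] B_lip[OF zD x1D w(1)] bdd[OF w(1)] by auto
      ultimately have "c * \<epsilon> * norm (z - x1) \<le> A x1 + C - \<delta>"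
        using w(2) unfolding M_def by (simp add: algebra_simps)
      then have "c * \<epsilon> * norm (z - x1) < \<bar>A x1 + C - \<delta>\<bar> + 1"
        by linarith
      then show ?thesis
        using nonneg(1) \<epsilon> by (simp add: \<rho>_def field_simps)
    qed
    have "continuous_on D (\<lambda>z. ?B z v)" if "v \<in> U" for v
      using that nonneg by (intro lipschitz_on_continuous_on[of LB] lipschitz_onI)
        (auto simp: dist_norm B_lip)
    note cont = this
    obtain z where z: "H z = H x1" "\<sigma> z + \<kappa> * norm (z - x1) \<le> 0"
      and stat: "\<And>v. v \<in> U \<Longrightarrow> \<bar>?B z v\<bar> \<le> \<kappa> * g"
    proof (rule stationary_point_on_level_set[where \<sigma> = \<sigma> and \<sigma>' = \<sigma>' and H = H and H' = H' and G = G
            and U = U and D = D and g = g and \<kappa> = \<kappa> and \<rho> = \<rho>, OF assms(1,2) \<sigma>' H' HG g \<kappa> cont x1 coercive])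
      fix z assume "H z = H x1" "\<sigma> z + \<kappa> * norm (z - x1) \<le> 0"
        "\<And>u. u \<in> U \<Longrightarrow> \<bar>?B z u\<bar> \<le> \<kappa> * g"
      then show thesis by (rule that)
    qed
    have zD: "z \<in> D" using z x1_D by auto
    obtain w where w: "w \<in> U" "\<delta> \<le> A z + ?B z w + c * \<sigma> z"
      using feasible[OF zD] by auto
    have "c * \<sigma> z + (M + c * \<epsilon>) * norm (z - x1) \<le> 0"
      using mult_left_mono[OF z(2), of c] nonneg(1) unfolding c\<kappa>[symmetric]
      by (simp add: algebra_simps)
    moreover have "0 \<le> c * \<epsilon> * norm (z - x1)"
      using nonneg(1) \<epsilon> by simp
    \<comment> \<open>\<open>stat\<close> bounds the input term at \<open>z\<close> from above for
      \<open>w\<close> and from below for \<open>u\<close>.\<close>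
    ultimately have "\<delta> \<le> A x1 + ?B x1 u + 2 * (\<kappa> * g)"
      using w(2) stat[OF w(1)] stat[OF u] A_lip[OF zD x1D] B_lip[OF zD x1D u]
      unfolding M_def by (simp add: algebra_simps abs_le_iff)
    then show ?thesis
      by (simp add: \<kappa>_def algebra_simps)
  qed
  note bound = this
  show ?thesis
  proof (rule field_le_epsilon)
    fix e :: real assume e: "0 < e"
    \<comment> \<open>The denominator \<open>2 * g + 1\<close> also covers
      \<open>g = 0\<close>.\<close>
    have "2 * g * (e / (2 * g + 1)) \<le> e"
      using \<open>0 \<le> g\<close> e by (simp add: field_simps)
    then show "\<delta> - 2 * ((LA + LB) / c) * g \<le> A x1 + ?B x1 u + e"
      using bound[of "e / (2 * g + 1)"] \<open>0 \<le> g\<close> e unfolding M_def by simp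
  qed
qed

section \<open>Positive semidefinite matrix curves\<close>

lemma psd_nonneg: "psd A \<Longrightarrow> 0 \<le> v \<bullet> (A *v v)"
  by (simp add: psd_def)

lemma tendsto_quadratic_form:
  fixes A :: "'b \<Rightarrow> real ^ 'p ^ 'p"
  assumes "(A \<longlongrightarrow> A0) F" "(e \<longlongrightarrow> e0) F"
  shows "((\<lambda>n. e n \<bullet> (A n *v e n)) \<longlongrightarrow> e0 \<bullet> (A0 *v e0)) F"
  unfolding inner_vec_def matrix_vector_mult_def
  by (simp, intro tendsto_intros assms)

text \<open>Failure arbitrarily soon after \<open>b\<close> yields times tending to \<open>b\<close>
  and unit vectors with negative form. They accumulate at a unit vector where the form of
  \<open>X b\<close> vanishes, and the difference quotients give a nonpositive form of
  \<open>X'\<close> there, against \<open>pos\<close>.\<close>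

lemma psd_right_after:
  fixes X :: "real \<Rightarrow> real ^ 'p ^ 'p"
  assumes sym: "\<And>t. transpose (X t) = X t"
    and "b < b'" and X': "(X has_vector_derivative X') (at b within {b..<b'})"
    and psd: "psd (X b)"
    and pos: "\<And>e. norm e = 1 \<Longrightarrow> e \<bullet> (X b *v e) = 0 \<Longrightarrow> 0 < e \<bullet> (X' *v e)"
  obtains \<epsilon> where "0 < \<epsilon>" "\<And>t. b \<le> t \<Longrightarrow> t < b + \<epsilon> \<Longrightarrow> psd (X t)"
proof -
  have "\<exists>\<epsilon>>0. \<forall>t. b \<le> t \<longrightarrow> t < b + \<epsilon> \<longrightarrow> psd (X t)"
  proof (rule ccontr)
    assume "\<not> ?thesis"
    then have neg: "\<exists>t. b \<le> t \<and> t < b + \<epsilon> \<and> \<not> psd (X t)" if "0 < \<epsilon>" for \<epsilon>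
      using that by blast
    define \<epsilon> where "\<epsilon> n = min (b' - b) (inverse (real (Suc n)))" for n
    have \<epsilon>: "0 < \<epsilon> n" for n
      using \<open>b < b'\<close> by (simp add: \<epsilon>_def)
    have "\<exists>t e. b \<le> t \<and> t < b + \<epsilon> n \<and> norm e = 1 \<and> e \<bullet> (X t *v e) < 0" for n
      using neg[OF \<epsilon>[of n]] psd_normI[OF sym] by (meson not_le)
    then obtain t e where te: "\<And>n. b \<le> t n" "\<And>n. t n < b + \<epsilon> n" "\<And>n. norm (e n) = 1"
      "\<And>n. e n \<bullet> (X (t n) *v e n) < 0"
      by metis
    have t_neq: "t n \<noteq> b" for n
      using te(4)[of n] psd_nonneg[OF psd, of "e n"] by auto
    have "(\<lambda>n. b + inverse (real (Suc n))) \<longlonglongrightarrow> b + 0"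
      by (intro tendsto_intros LIMSEQ_inverse_real_of_nat)
    moreover have "t n \<le> b + inverse (real (Suc n))" for n
      using te(2)[of n] unfolding \<epsilon>_def by linarith
    ultimately have t_lim: "t \<longlonglongrightarrow> b"
      using te(1)
      by (intro tendsto_sandwich[OF _ _ tendsto_const, of b t _ "\<lambda>n. b + inverse (real (Suc n))"]
          always_eventually) auto
    have "((\<lambda>s. (X s - X b) /\<^sub>R (s - b)) \<longlongrightarrow> X') (at b within {b..<b'})"
    proof -
      have "((\<lambda>s. (X s - X b - (s - b) *\<^sub>R X') /\<^sub>R norm (s - b)) \<longlongrightarrow> 0) (at b within {b..<b'})"
        using X' by (simp add: has_vector_derivative_def has_derivative_at_within)
      moreover have "\<forall>\<^sub>F s in at b within {b..<b'}.
          (X s - X b - (s - b) *\<^sub>R X') /\<^sub>R norm (s - b) = (X s - X b) /\<^sub>R (s - b) - X'"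
        by (auto simp: eventually_at_filter scaleR_diff_right intro!: always_eventually)
      ultimately have "((\<lambda>s. (X s - X b) /\<^sub>R (s - b) - X') \<longlongrightarrow> 0) (at b within {b..<b'})"
        by (rule Lim_transform_eventually)
      then show ?thesis
        by (rule LIM_zero_cancel)
    qed
    moreover have t_filter: "filterlim t (at b within {b..<b'}) sequentially"
    proof (rule filterlim_at_withinI[OF t_lim always_eventually])
      show "\<forall>n. t n \<in> {b..<b'} - {b}"
      proof
        fix n
        show "t n \<in> {b..<b'} - {b}"
          using te(1,2)[of n] t_neq[of n] unfolding \<epsilon>_def by auto
      qed
    qed
    ultimately have D_lim: "(\<lambda>n. (X (t n) - X b) /\<^sub>R (t n - b)) \<longlonglongrightarrow> X'"
      by (rule filterlim_compose)
    obtain e0 s where e0: "norm e0 = 1" "strict_mono s" "(e \<circ> s) \<longlonglongrightarrow> e0"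
      using compact_sphere[of "0 :: real ^ 'p" 1] te(3) unfolding compact_def
      by (metis mem_sphere_0)
    note lims = e0(3)[unfolded o_def] LIMSEQ_subseq_LIMSEQ[OF D_lim e0(2), unfolded o_def]
    have X_lim: "(\<lambda>n. X (t (s n))) \<longlonglongrightarrow> X b"
    proof -
      have "continuous (at b within {b..<b'}) X"
        using X' has_vector_derivative_continuous by blast
      then have "(\<lambda>n. X (t n)) \<longlonglongrightarrow> X b"
        unfolding continuous_within by (rule filterlim_compose[OF _ t_filter])
      then show ?thesis
        using LIMSEQ_subseq_LIMSEQ[OF _ e0(2)] by (force simp: o_def)
    qed
    have "(\<lambda>n. e (s n) \<bullet> (X (t (s n)) *v e (s n))) \<longlonglongrightarrow> e0 \<bullet> (X b *v e0)"
      by (intro tendsto_quadratic_form X_lim lims)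
    then have "e0 \<bullet> (X b *v e0) \<le> 0"
      by (rule LIMSEQ_le_const2) (use te(4) in \<open>auto intro: less_imp_le\<close>)
    then have "0 < e0 \<bullet> (X' *v e0)"
      using psd_nonneg[OF psd, of e0] e0(1) by (intro pos) auto
    moreover have "(\<lambda>n. e (s n) \<bullet> (((X (t (s n)) - X b) /\<^sub>R (t (s n) - b)) *v e (s n))) \<longlonglongrightarrow> e0 \<bullet> (X' *v e0)"
      by (intro tendsto_quadratic_form lims)
    then have "e0 \<bullet> (X' *v e0) \<le> 0"
    proof (rule LIMSEQ_le_const2, intro exI allI impI)
      fix n
      let ?t = "t (s n)" and ?e = "e (s n)"
      have "0 < ?t - b" using te(1)[of "s n"] t_neq[of "s n"] by simp
      moreover have "?e \<bullet> ((X ?t - X b) *v ?e) \<le> 0"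
        using te(4)[of "s n"] psd_nonneg[OF psd, of ?e]
        by (simp add: matrix_vector_mult_diff_rdistrib inner_diff_right)
      ultimately show "?e \<bullet> (((X ?t - X b) /\<^sub>R (?t - b)) *v ?e) \<le> 0"
        by (simp add: scaleR_matrix_vector_assoc[symmetric] mult_le_0_iff)
    qed
    ultimately show False by simp
  qed
  then show thesis using that by blast
qed

text \<open>With the integrating factor \<open>exp (c * (s - b))\<close> every quadratic form of
  \<open>X\<close> becomes nondecreasing.\<close>

lemma psd_of_linear_differential_inequality:
  fixes X :: "real \<Rightarrow> real ^ 'p ^ 'p"
  assumes sym: "\<And>t. transpose (X t) = X t"
    and X': "\<And>t. b \<le> t \<Longrightarrow> t < b' \<Longrightarrow> (X has_vector_derivative X' t) (at t within {b..<b'})"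
    and psd': "\<And>t. b \<le> t \<Longrightarrow> t < b' \<Longrightarrow> psd (X' t + c *\<^sub>R X t)"
    and psd: "psd (X b)" and t: "b \<le> t" "t < b'"
  shows "psd (X t)"
proof (rule psd_normI[OF sym])
  fix e :: "real ^ 'p" assume "norm e = 1"
  let ?q = "\<lambda>A. e \<bullet> (A *v e)"
  let ?f = "\<lambda>s. exp (c * (s - b)) * ?q (X s)"
  have q': "((\<lambda>s. ?q (X s)) has_real_derivative ?q (X' s)) (at s within {b..<b'})"
    if "b \<le> s" "s < b'" for s
    using bounded_linear.has_vector_derivative[OF bounded_linear_quadratic_form X'[OF that], of e]
    by (simp add: has_real_derivative_iff_has_vector_derivative)
  have "?f b \<le> ?f t"
  proof (rule nondecreasing_from_derivative[of b t ?f "\<lambda>s. exp (c * (s - b)) * ?q (X' s + c *\<^sub>R X s)"])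
    have "continuous_on {b..<b'} (\<lambda>s. ?q (X s))"
      using q' by (intro DERIV_continuous_on) auto
    then have "continuous_on {b..t} (\<lambda>s. ?q (X s))"
      by (rule continuous_on_subset) (use t in auto)
    then show "continuous_on {b..t} ?f"
      by (intro continuous_on_mult[of _ "\<lambda>s. exp (c * (s - b))"]) (auto intro!: continuous_intros)
  next
    fix s assume s: "b < s" "s < t"
    have "(at s within {b..<b'}) = at s"
      using s t by (intro at_within_interior) auto
    then have "((\<lambda>s. ?q (X s)) has_real_derivative ?q (X' s)) (at s)"
      using q'[of s] s t by simp
    then show "(?f has_real_derivative exp (c * (s - b)) * ?q (X' s + c *\<^sub>R X s)) (at s)"
      by (auto intro!: derivative_eq_intros
          simp: algebra_simps matrix_vector_mult_add_rdistrib scaleR_matrix_vector_assoc[symmetric] inner_add_right)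
    show "0 \<le> exp (c * (s - b)) * ?q (X' s + c *\<^sub>R X s)"
      using psd_nonneg[OF psd'[of s]] s t by simp
  qed (use t in auto)
  moreover have "0 \<le> ?f b"
    using psd_nonneg[OF psd] by simp
  ultimately have "0 \<le> ?f t" by linarith
  then show "0 \<le> ?q (X t)"
    by (simp add: zero_le_mult_iff)
qed

section \<open>Sampled trajectories\<close>

text \<open>Supplies the hypothesis \<open>pos\<close> of \<open>psd_right_after\<close> along a
  trajectory: \<open>a\<close> stands for the last sampling time, \<open>u\<close> for the held
  input, \<open>\<psi>\<close> for the member at which the inputs enter the derivative. The
  disjunction \<open>degree\<close> separates relative degree one from higher degrees.\<close>

lemma rate_pos_at_zero:
  fixes F :: "real ^ 'n \<Rightarrow> real ^ 'n" and G :: "real ^ 'n \<Rightarrow> real ^ 'm ^ 'n"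
    and H \<psi> :: "real ^ 'n \<Rightarrow> real ^ 'p ^ 'p" and x :: "real \<Rightarrow> real ^ 'n"
  assumes "open D" and safe_D: "\<And>z. psd (H z) \<Longrightarrow> z \<in> D"
    and H': "\<And>z. (H has_derivative H' z) (at z)"
    and \<psi>': "\<And>z. (\<psi> has_derivative \<psi>' z) (at z)"
    and degree: "\<psi> = H \<or> (\<forall>z u. H' z (G z *v u) = 0)"
    and H_lip: "\<And>y z. y \<in> D \<Longrightarrow> z \<in> D \<Longrightarrow> spectral_norm (H y - H z) \<le> L_H * norm (y - z)"
    and F_lip: "\<And>y z. y \<in> D \<Longrightarrow> z \<in> D \<Longrightarrow>
      spectral_norm (\<psi>' y (F y) - \<psi>' z (F z)) \<le> L_F * norm (y - z)"
    and G_lip: "\<And>y z u. y \<in> D \<Longrightarrow> z \<in> D \<Longrightarrow>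
      spectral_norm (\<psi>' y (G y *v u) - \<psi>' z (G z *v u)) \<le> L_G * norm (y - z) * norm u"
    and F_bound: "\<And>z. z \<in> D \<Longrightarrow> norm (F z) \<le> b_F"
    and G_bound: "\<And>z u. z \<in> D \<Longrightarrow> norm (G z *v u) \<le> b_G * norm u"
    and nonneg: "0 \<le> L_H" "0 \<le> L_F" "0 \<le> L_G" "0 \<le> b_F" "0 \<le> b_G" "0 \<le> b_u" and "0 < c"
    and \<delta>: "\<delta> = \<Delta> * (L_F + L_G * b_u + c * L_H) * (b_F + b_G * b_u)" "0 < \<delta>" and "0 < \<Delta>"
    and feasible: "\<And>z. z \<in> D \<Longrightarrow> \<exists>u. norm u \<le> b_u \<and>
      psd (\<psi>' z (F z) + \<psi>' z (G z *v u) + c *\<^sub>R \<psi> z - \<delta> *\<^sub>R mat 1)"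
    and ab: "a \<le> b" "b < a + \<Delta>" and cont: "continuous_on {a..b} x"
    and x': "\<And>t. a < t \<Longrightarrow> t < b \<Longrightarrow> (x has_vector_derivative F (x t) + G (x t) *v u) (at t)"
    and u: "norm u \<le> b_u"
    and safe: "\<And>t. a \<le> t \<Longrightarrow> t \<le> b \<Longrightarrow> psd (H (x t))"
    and start: "psd (\<psi> (x a))"
      "psd (\<psi>' (x a) (F (x a)) + \<psi>' (x a) (G (x a) *v u) + c *\<^sub>R \<psi> (x a) - \<delta> *\<^sub>R mat 1)"
    and e: "norm e = 1" "e \<bullet> (\<psi> (x b) *v e) = 0"
  shows "0 < e \<bullet> (\<psi>' (x b) (F (x b) + G (x b) *v u) *v e)"
proof -
  let ?q = "\<lambda>A :: real ^ 'p ^ 'p. e \<bullet> (A *v e)"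
  define \<sigma> where "\<sigma> z = ?q (\<psi> z)" for z
  define \<sigma>' where "\<sigma>' z v = ?q (\<psi>' z v)" for z v
  define A where "A z = \<sigma>' z (F z)" for z
  \<comment> \<open>\<open>M\<close> is a Lipschitz constant of the rate in the state and
    \<open>V\<close> bounds the speed, so \<open>R\<close> varies in time with constant
    \<open>M * V\<close>.\<close>
  define M where "M = L_F + L_G * b_u"
  define V where "V = b_F + b_G * b_u"
  define R where "R t = A (x t) + \<sigma>' (x t) (G (x t) *v u)" for t
  have q_diff: "?q (X - Y) = ?q X - ?q Y" for X Y
    by (simp add: matrix_vector_mult_diff_rdistrib inner_diff_right)
  have q_add: "?q (X + Y) = ?q X + ?q Y" for X Y
    by (simp add: matrix_vector_mult_add_rdistrib inner_add_right)
  have q_scale: "?q (k *\<^sub>R X) = k * ?q X" for k X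
    by (simp add: scaleR_matrix_vector_assoc[symmetric])
  have q_id: "e \<bullet> e = 1"
    using e(1) by (simp add: norm_eq_1)
  have MV: "0 \<le> M" "0 \<le> V"
    using nonneg by (auto simp: M_def V_def)
  have xD: "x t \<in> D" if "a \<le> t" "t \<le> b" for t
    using safe_D safe that by blast
  have \<psi>'_lin: "linear (\<psi>' z)" for z
    using \<psi>' has_derivative_linear by blast
  have \<sigma>_deriv: "(\<sigma> has_derivative \<sigma>' z) (at z)" for z
    unfolding \<sigma>_def \<sigma>'_def
    by (rule bounded_linear.has_derivative[OF bounded_linear_quadratic_form \<psi>'])
  have R_eq: "R t = \<sigma>' (x t) (F (x t) + G (x t) *v u)" for t
    by (simp add: R_def A_def \<sigma>'_def linear_add[OF \<psi>'_lin] q_add)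
  have A_lip: "\<bar>A y - A z\<bar> \<le> L_F * norm (y - z)" if "y \<in> D" "z \<in> D" for y z
    using abs_quadratic_form_le[OF e(1), of "\<psi>' y (F y) - \<psi>' z (F z)"] F_lip[OF that]
    by (simp add: A_def \<sigma>'_def q_diff)
  have B_lip: "\<bar>\<sigma>' y (G y *v w) - \<sigma>' z (G z *v w)\<bar> \<le> L_G * b_u * norm (y - z)"
    if "y \<in> D" "z \<in> D" "norm w \<le> b_u" for y z w
  proof -
    have "\<bar>\<sigma>' y (G y *v w) - \<sigma>' z (G z *v w)\<bar> \<le> L_G * norm (y - z) * norm w"
      using abs_quadratic_form_le[OF e(1), of "\<psi>' y (G y *v w) - \<psi>' z (G z *v w)"]
        G_lip[OF that(1,2), of w] by (simp add: \<sigma>'_def q_diff)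
    also have "\<dots> \<le> L_G * norm (y - z) * b_u"
      using that nonneg by (intro mult_left_mono) auto
    finally show ?thesis by (simp add: mult_ac)
  qed
  have G_b: "norm (G z *v w) \<le> b_G * b_u" if "z \<in> D" "norm w \<le> b_u" for z w
    using G_bound[OF that(1), of w] mult_left_mono[OF that(2) nonneg(5)] by linarith
  have speed: "norm (x t - x s) \<le> V * (t - s)" if st: "a \<le> s" "s \<le> t" "t \<le> b" for s t
  proof (cases "s = t")
    case False
    have "\<exists>\<xi>\<in>{s<..<t}. norm (x t - x s) \<le> norm ((t - s) *\<^sub>R (F (x \<xi>) + G (x \<xi>) *v u))"
    proof (rule mvt_general)
      show "continuous_on {s..t} x"
        by (rule continuous_on_subset[OF cont]) (use st in auto)
    qed (use st False x' in \<open>auto simp: has_vector_derivative_def\<close>)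
    then obtain \<xi> where \<xi>: "s < \<xi>" "\<xi> < t"
      "norm (x t - x s) \<le> norm ((t - s) *\<^sub>R (F (x \<xi>) + G (x \<xi>) *v u))" by auto
    have "x \<xi> \<in> D"
      using \<xi> st by (intro xD) auto
    then have le_V: "norm (F (x \<xi>) + G (x \<xi>) *v u) \<le> V"
      using norm_triangle_ineq[of "F (x \<xi>)" "G (x \<xi>) *v u"] F_bound[of "x \<xi>"] G_b[of "x \<xi>" u] u
      unfolding V_def by linarith
    have "(t - s) * norm (F (x \<xi>) + G (x \<xi>) *v u) \<le> V * (t - s)"
      using mult_left_mono[OF le_V, of "t - s"] st by (simp add: mult.commute)
    then show ?thesis
      using \<xi>(3) st by simp
  qed simp
  have R_lip: "\<bar>R t - R s\<bar> \<le> M * V * (t - s)" if st: "a \<le> s" "s \<le> t" "t \<le> b" for s t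
  proof -
    have D: "x t \<in> D" "x s \<in> D" using st by (auto intro: xD)
    have "\<bar>R t - R s\<bar> \<le> M * norm (x t - x s)"
      using A_lip[OF D] B_lip[OF D u] unfolding R_def M_def distrib_right by linarith
    also have "\<dots> \<le> M * (V * (t - s))"
      using speed[OF st] MV by (intro mult_left_mono)
    finally show ?thesis by simp
  qed
  have R_start: "\<delta> \<le> R a + c * \<sigma> (x a)"
    using psd_nonneg[OF start(2), of e]
    by (simp add: q_diff q_add q_scale q_id R_def A_def \<sigma>'_def \<sigma>_def)
  have \<delta>_eq: "\<delta> = \<Delta> * ((M + c * L_H) * V)"
    by (simp add: \<delta>(1) M_def V_def)
  have "0 < R b"
    using degree
  proof
    \<comment> \<open>Degree one: as \<open>\<sigma>\<close> vanishes at \<open>x b\<close>, it is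
      at most \<open>L_H * V * (b - a)\<close> at \<open>x a\<close>. The total loss
      \<open>(b - a) * ((M + c * L_H) * V)\<close> stays below \<open>\<delta>\<close> because
      \<open>b - a < \<Delta>\<close>.\<close>
    assume [simp]: "\<psi> = H"
    have "\<bar>\<sigma> (x b) - \<sigma> (x a)\<bar> \<le> L_H * norm (x b - x a)"
      using abs_quadratic_form_le[OF e(1), of "H (x b) - H (x a)"] H_lip[of "x b" "x a"] xD ab
      by (simp add: \<sigma>_def q_diff)
    also have "\<dots> \<le> L_H * (V * (b - a))"
      using speed[of a b] ab nonneg by (intro mult_left_mono) auto
    finally have "c * \<sigma> (x a) \<le> c * (L_H * (V * (b - a)))"
      using e(2) \<open>0 < c\<close> by (intro mult_left_mono) (auto simp: \<sigma>_def)
    moreover have "(b - a) * ((M + c * L_H) * V) < \<delta>"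
      using \<delta>(2) ab \<open>0 < \<Delta>\<close> unfolding \<delta>_eq by (intro mult_strict_right_mono) (auto simp: zero_less_mult_iff)
    ultimately show ?thesis
      using R_start R_lip[of a b] ab by (simp add: algebra_simps)
  next
    assume HG: "\<forall>z u. H' z (G z *v u) = 0"
    have "linear (\<lambda>w. \<sigma>' (x b) (G (x b) *v w))"
      unfolding \<sigma>'_def
      by (rule linearI) (simp_all add: matrix_vector_right_distrib linear_add[OF \<psi>'_lin] q_add
          matrix_vector_mult_scaleR linear_scale[OF \<psi>'_lin] q_scale)
    then obtain C where C: "0 < C" "\<And>w. \<bar>\<sigma>' (x b) (G (x b) *v w)\<bar> \<le> C * norm w"
      using linear_bounded_pos by (metis real_norm_def)
    \<comment> \<open>The ball of radius \<open>b_u\<close> serves as input set: it contains both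
      \<open>u\<close> and the inputs from \<open>feasible\<close>.\<close>
    have "\<delta> - 2 * ((L_F + L_G * b_u) / c) * (b_G * b_u) \<le> A (x b) + \<sigma>' (x b) (G (x b) *v u)"
    proof (rule crossing_rate_lower_bound[where \<sigma> = \<sigma> and \<sigma>' = \<sigma>' and A = A and H = H and H' = H'
          and G = "\<lambda>z u. G z *v u" and U = "{w. norm w \<le> b_u}" and D = D and C = "C * b_u"])
      \<comment> \<open>A level set of \<open>H\<close> through a safe state consists of safe
        states.\<close>
      show "{z. H z = H (x b)} \<subseteq> D"
        using safe_D safe[of b] ab by auto
      show "\<exists>w\<in>{w. norm w \<le> b_u}. \<delta> \<le> A z + \<sigma>' z (G z *v w) + c * \<sigma> z" if zD: "z \<in> D" for z
      proof -
        obtain w where w: "norm w \<le> b_u"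
          "psd (\<psi>' z (F z) + \<psi>' z (G z *v w) + c *\<^sub>R \<psi> z - \<delta> *\<^sub>R mat 1)"
          using feasible[OF zD] by auto
        then show ?thesis
          using psd_nonneg[OF w(2), of e]
          by (auto simp: q_diff q_add q_scale q_id A_def \<sigma>'_def \<sigma>_def)
      qed
      show "\<sigma>' (x b) (G (x b) *v w) \<le> C * b_u" if "w \<in> {w. norm w \<le> b_u}" for w
      proof -
        have "C * norm w \<le> C * b_u"
          using that C(1) by (intro mult_left_mono) auto
        then show ?thesis
          using C(2)[of w] by linarith
      qed
      show "\<sigma> (x b) = 0"
        using e(2) by (simp add: \<sigma>_def)
    qed (use assms(1) \<sigma>_deriv H' HG G_b A_lip B_lip nonneg \<open>0 < c\<close> u in auto)
    \<comment> \<open>Weakening \<open>b_G * b_u\<close> to \<open>V\<close> gives the form with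
      \<open>m = M * V\<close> expected by \<open>crossing_rate_pos\<close>.\<close>
    moreover have "2 * (M / c) * (b_G * b_u) \<le> 2 * (M / c) * V"
      using MV nonneg \<open>0 < c\<close> by (intro mult_left_mono) (auto simp: V_def)
    ultimately have "\<delta> - 2 * (M / c) * V \<le> R b"
      unfolding R_def M_def by linarith
    then have R_b: "\<delta> - 2 * (M * V) / c \<le> R b"
      by (simp add: mult.assoc)
    show ?thesis
    proof (rule crossing_rate_pos[where \<sigma> = "\<lambda>t. \<sigma> (x t)" and a = a and b = b and \<Delta> = \<Delta> and c = c
          and m = "M * V" and \<delta> = \<delta> and R = R])
      show "\<Delta> * (M * V) \<le> \<delta>"
        using MV nonneg \<open>0 < c\<close> \<open>0 < \<Delta>\<close> unfolding \<delta>_eq by (intro mult_left_mono mult_right_mono) auto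
      have "continuous_on UNIV \<sigma>"
        by (meson \<sigma>_deriv continuous_at_imp_continuous_on has_derivative_continuous)
      then show "continuous_on {a..b} (\<lambda>t. \<sigma> (x t))"
        using continuous_on_compose2[OF _ cont] by blast
      show "((\<lambda>t. \<sigma> (x t)) has_real_derivative R t) (at t)" if "a < t" "t < b" for t
      proof -
        have "((\<lambda>t. \<sigma> (x t)) has_derivative (\<lambda>h. \<sigma>' (x t) (h *\<^sub>R (F (x t) + G (x t) *v u)))) (at t)"
          using has_derivative_compose[OF _ \<sigma>_deriv] x'[OF that]
          unfolding has_vector_derivative_def by blast
        then show ?thesis
          unfolding R_eq
          by (rule has_derivative_imp_has_field_derivative)
            (simp add: \<sigma>'_def linear_scale[OF \<psi>'_lin] q_scale mult.commute)
      qed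
      show "0 \<le> \<sigma> (x a)"
        using psd_nonneg[OF start(1), of e] by (simp add: \<sigma>_def)
      show "\<sigma> (x b) = 0"
        using e(2) by (simp add: \<sigma>_def)
    qed (use ab \<open>0 < c\<close> MV \<delta>(2) R_lip R_start R_b in auto)
  qed
  then show ?thesis
    by (simp add: R_eq \<sigma>'_def)
qed

text \<open>Continuous induction: at the infimum \<open>b\<close> of the exit times closedness gives
  \<open>x b \<in> C\<close>, and \<open>step\<close> then moves all exit times beyond
  \<open>b\<close>.\<close>

lemma first_exit_induct:
  fixes x :: "real \<Rightarrow> 's::t2_space" and T :: ereal
  assumes "closed C" and cont: "continuous_on {t. t0 \<le> t \<and> ereal t < T} x" and init: "x t0 \<in> C"
    and step: "\<And>b. t0 \<le> b \<Longrightarrow> ereal b < T \<Longrightarrow> (\<And>t. t0 \<le> t \<Longrightarrow> t \<le> b \<Longrightarrow> x t \<in> C) \<Longrightarrow>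
      \<exists>b'>b. \<forall>t. b \<le> t \<and> t < b' \<longrightarrow> x t \<in> C"
    and t: "t0 \<le> t" "ereal t < T"
  shows "x t \<in> C"
proof (rule ccontr)
  assume "x t \<notin> C"
  define E where "E = {s. t0 \<le> s \<and> ereal s < T \<and> x s \<notin> C}"
  have tE: "t \<in> E"
    using t \<open>x t \<notin> C\<close> by (simp add: E_def)
  have bdd: "bdd_below E"
    by (rule bdd_belowI[of _ t0]) (simp add: E_def)
  define b where "b = Inf E"
  have b_t: "b \<le> t"
    unfolding b_def using tE bdd by (rule cInf_lower)
  have b: "t0 \<le> b"
    unfolding b_def using tE by (intro cInf_greatest) (auto simp: E_def)
  have bT: "ereal b < T"
    using b_t t(2) by (metis ereal_less_eq(3) order_le_less_trans)
  have before: "x s \<in> C" if "t0 \<le> s" "s < b" for s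
  proof (rule ccontr)
    assume "x s \<notin> C"
    moreover have "ereal s < T"
      using that(2) bT by (metis ereal_less_eq(3) less_imp_le order_le_less_trans)
    ultimately have "s \<in> E"
      using that by (simp add: E_def)
    then show False
      using cInf_lower[OF _ bdd, of s] that by (simp add: b_def)
  qed
  have "x b \<in> C"
  proof (cases "b = t0")
    case False
    have "continuous_on {t0..b} x"
      by (rule continuous_on_subset[OF cont])
        (use bT in \<open>auto intro: order_le_less_trans[of _ "ereal b"]\<close>)
    then have "closed ({t0..b} \<inter> x -` C)"
      using \<open>closed C\<close> by (intro continuous_closed_preimage) auto
    moreover have "{t0<..<b} \<subseteq> {t0..b} \<inter> x -` C"
      using before by auto
    ultimately have "closure {t0<..<b} \<subseteq> {t0..b} \<inter> x -` C"
      by (rule closure_minimal[rotated])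
    then show ?thesis
      using False b by auto
  qed (use init in simp)
  then have "x s \<in> C" if "t0 \<le> s" "s \<le> b" for s
    using before that by (cases "s = b") auto
  then obtain b' where b': "b' > b" "\<And>s. b \<le> s \<Longrightarrow> s < b' \<Longrightarrow> x s \<in> C"
    using step[OF b bT] by blast
  have "b' \<le> Inf E"
  proof (rule cInf_greatest)
    fix s assume s: "s \<in> E"
    then have "b \<le> s"
      unfolding b_def using bdd by (intro cInf_lower)
    then show "b' \<le> s"
      using b'(2)[of s] s by (force simp: E_def)
  qed (use tE in auto)
  then show False
    using b'(1) by (simp add: b_def)
qed

text \<open>The normal and adversarial sums combine into the full input map at the stacked vector
  that the closed loop applies.\<close>

lemma Psi_top_eq:
  fixes su :: "'m::finite \<Rightarrow> 'a::finite"
  shows "Psi_top su \<A> umin F G H c r x w = lie F (Psi F H c (r - 1)) x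
    + lie_input G (Psi F H c (r - 1)) x (stack su (\<lambda>i. if i \<in> \<A> then umin i x else w i))
    + c r *\<^sub>R Psi F H c (r - 1) x"
proof -
  let ?l = "\<lambda>i. lie_agent su G i (Psi F H c (r - 1)) x"
  have "(\<Sum>i\<in>UNIV. ?l i (if i \<in> \<A> then umin i x else w i))
      = (\<Sum>i\<in>\<A>. ?l i (umin i x)) + (\<Sum>i\<in>-\<A>. ?l i (w i))"
    using sum.subset_diff[of \<A> UNIV "\<lambda>i. ?l i (if i \<in> \<A> then umin i x else w i)"]
    by (simp add: Compl_eq_Diff_UNIV add.commute)
  then show ?thesis
    by (simp add: Psi_top_def lie_input_stack)
qed

theorem theorem3:
  fixes sx :: "'n::finite \<Rightarrow> 'a::finite"
    and su :: "'m::finite \<Rightarrow> 'a"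
    and f :: "'a \<Rightarrow> real ^ 'n \<Rightarrow> real ^ 'n"
    and g :: "'a \<Rightarrow> real ^ 'n \<Rightarrow> real ^ 'm ^ 'n"
    and F :: "real ^ 'n \<Rightarrow> real ^ 'n"
    and G :: "real ^ 'n \<Rightarrow> real ^ 'm ^ 'n"
    and U :: "'a \<Rightarrow> (real ^ 'm) set"
    and \<A> :: "'a set"
    and umin :: "'a \<Rightarrow> real ^ 'n \<Rightarrow> real ^ 'm"
    and H :: "real ^ 'n \<Rightarrow> real ^ 'p::finite ^ 'p"
    and c :: "nat \<Rightarrow> real"
    and r :: nat
    and S D S_Q :: "(real ^ 'n) set"
    and \<kappa> :: "real ^ 'n \<Rightarrow> 'a \<Rightarrow> real ^ 'm"
    and t0 \<Delta>t b_u b_F b_G L_H L_FH L_GH Lhat_FH Lhat_GH \<delta> :: real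
  assumes f_maps: "\<And>i. f i \<in> agent_space sx i \<rightarrow> agent_space sx i"
    and f_lipschitz: "\<And>i. loc_lipschitz_on (agent_space sx i) (f i)"
    and g_maps: "\<And>i. g i \<in> agent_space sx i \<rightarrow> agent_mats sx su i"
    and g_lipschitz: "\<And>i. loc_lipschitz_on (agent_space sx i) (g i)"
    and F_def: "F = stacked_drift sx f"
    and G_def: "G = blkdiag_input sx su g"
    and \<Delta>t_pos: "\<Delta>t > 0"
    and U_space: "\<And>i. U i \<subseteq> agent_space su i"
    and U_nonempty: "\<And>i. U i \<noteq> {}"
    and U_convex: "\<And>i. convex (U i)"
    and U_compact: "\<And>i. compact (U i)"
    and b_u_def: "b_u = (SUP u\<in>input_set su U. norm u)"
    and H_sym: "\<And>x. transpose (H x) = H x"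
    and H_C1: "loc_lipschitz_C1 H"
    and S_def: "S = {x. psd (H x)}"
    and umin: "\<And>j x. j \<in> \<A> \<Longrightarrow> umin j x \<in> loewner_argmin (U j) (lie_agent su G j H x)"
    and rel_deg: "relative_degree su \<A> F G H c r"
    and Psi_C1: "\<And>q. q < r \<Longrightarrow> cont_diff 1 (Psi F H c q)"
    and D_domain: "open D" "connected D" "D \<noteq> {}"
    and S_D: "S \<subseteq> D"
    and consts_nonneg: "0 \<le> L_H" "0 \<le> L_FH" "0 \<le> L_GH" "0 \<le> Lhat_FH" "0 \<le> Lhat_GH"
    and H_lip: "\<And>x y. x \<in> D \<Longrightarrow> y \<in> D \<Longrightarrow>
      spectral_norm (H x - H y) \<le> L_H * norm (x - y)"
    and FH_lip: "\<And>x y. x \<in> D \<Longrightarrow> y \<in> D \<Longrightarrow>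
      spectral_norm (lie F H x - lie F H y) \<le> L_FH * norm (x - y)"
    and GH_lip: "\<And>x y. x \<in> D \<Longrightarrow> y \<in> D \<Longrightarrow>
      ind_norm (\<lambda>u. lie_input G H x u - lie_input G H y u) \<le> L_GH * norm (x - y)"
    and FPsi_lip: "\<And>x y. x \<in> D \<Longrightarrow> y \<in> D \<Longrightarrow>
      spectral_norm (lie F (Psi F H c (r - 1)) x - lie F (Psi F H c (r - 1)) y)
        \<le> Lhat_FH * norm (x - y)"
    and GPsi_lip: "\<And>x y. x \<in> D \<Longrightarrow> y \<in> D \<Longrightarrow>
      ind_norm (\<lambda>u. lie_input G (Psi F H c (r - 1)) x u - lie_input G (Psi F H c (r - 1)) y u)
        \<le> Lhat_GH * norm (x - y)"
    and b_pos: "0 < b_F" "0 < b_G"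
    and F_bound: "\<And>x. x \<in> D \<Longrightarrow> norm (F x) \<le> b_F"
    and G_bound: "\<And>x. x \<in> D \<Longrightarrow> spectral_norm (G x) \<le> b_G"
    and \<delta>_def: "\<delta> = \<Delta>t * (Lhat_FH + Lhat_GH * b_u + c r * L_H) * (b_F + b_G * b_u)"
    and S_Q_def: "S_Q = (\<Inter>q\<in>{1..r}. {x. psd (Psi F H c (q - 1) x)})"
    and MCBF: "high_order_ARZE_MCBF su \<A> U umin F G H c r \<delta> D"
    and \<kappa>_safe: "\<And>T x k. closed_loop_trajectory su \<A> umin F G t0 \<Delta>t \<kappa> T x \<Longrightarrow> x t0 \<in> S_Q \<Longrightarrow>
      ereal (sample_time t0 \<Delta>t k) < T \<Longrightarrow>
      \<kappa> (x (sample_time t0 \<Delta>t k))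
        \<in> safe_inputs su \<A> U umin F G H c r \<delta> (x (sample_time t0 \<Delta>t k))"
  shows "forward_invariant t0 (closed_loop_trajectory su \<A> umin F G t0 \<Delta>t \<kappa>) S_Q"
  unfolding forward_invariant_def
proof (intro allI impI, elim conjE)
  fix T x t
  assume traj: "closed_loop_trajectory su \<A> umin F G t0 \<Delta>t \<kappa> T x" and init: "x t0 \<in> S_Q"
    and t: "t0 \<le> t" "ereal t < T"

  \<comment> \<open>Regularity, symmetry and input bounds\<close>
  have r: "1 \<le> r"
    using rel_deg by (simp add: relative_degree_def)
  have c_pos: "0 < c q" if "1 \<le> q" "q \<le> r" for q
    using MCBF that by (simp add: high_order_ARZE_MCBF_def)
  let ?P = "Psi F H c"
  let ?P' = "\<lambda>q z. frechet_derivative (?P q) (at z)"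
  have P': "(?P q has_derivative ?P' q z) (at z)" if "q < r" for q z
    using Psi_C1[OF that] by (simp add: frechet_derivative_works)
  have P'_lin: "linear (?P' q z)" if "q < r" for q z
    using P'[OF that] has_derivative_linear by blast
  have lie_F: "lie F (?P q) z = ?P' q z (F z)" if "q < r" for q z
    by (rule lie_eq_derivative[OF P'[OF that]])
  have lie_G: "lie_input G (?P q) z v = ?P' q z (G z *v v)" if "q < r" for q z v
    by (rule lie_input_eq_derivative[OF P'[OF that]])
  have P_sym: "transpose (?P q z) = ?P q z" for q z
    by (rule transpose_Psi[OF H_sym])
  \<comment> \<open>The shift \<open>q - 1\<close> maps \<open>{1..r}\<close> onto
    \<open>{..<r}\<close>.\<close>
  have S_Q_iff: "z \<in> S_Q \<longleftrightarrow> (\<forall>q<r. psd (?P q z))" for z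
  proof -
    have "(\<lambda>q. q - 1) ` {1..r} = {..<r}"
    proof -
      have "q \<in> (\<lambda>q. q - 1) ` {1..r}" if "q < r" for q
        using that by (intro image_eqI[of _ _ "Suc q"]) auto
      then show ?thesis by auto
    qed
    moreover have "z \<in> S_Q \<longleftrightarrow> (\<forall>q\<in>(\<lambda>q. q - 1) ` {1..r}. psd (?P q z))"
      by (simp add: S_Q_def)
    ultimately show ?thesis by (simp add: lessThan_def)
  qed
  have safe_D: "z \<in> D" if "psd (H z)" for z
    using that S_D by (auto simp: S_def)
  have S_Q_safe: "psd (H z)" if "z \<in> S_Q" for z
    using that r S_Q_iff[of z] by (metis Psi.simps(1) less_eq_Suc_le One_nat_def)
  have stack_bound: "norm (stack su w) \<le> b_u" if "\<And>i. w i \<in> U i" for w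
    unfolding b_u_def by (rule norm_stack_le_SUP[OF U_space U_compact that])
  have umin_U: "umin j z \<in> U j" if "j \<in> \<A>" for j z
    using umin[OF that] by (simp add: loewner_argmin_def)
  have b_u: "0 \<le> b_u"
  proof -
    have "\<forall>i. \<exists>w. w \<in> U i"
      using U_nonempty by blast
    then obtain w where "\<And>i. w i \<in> U i"
      by metis
    from order_trans[OF norm_ge_zero stack_bound[OF this]] show ?thesis .
  qed

  \<comment> \<open>Strict positivity of the margin\<close>
  have "L_H \<noteq> 0"
  proof
    \<comment> \<open>Then \<open>H\<close> is constant on \<open>D\<close>, so the safe set,
      nonempty by the initial state, equals \<open>D\<close>. Being open and closed it is the whole
      space, and a constant \<open>H\<close> contradicts the appearance of inputs at level
      \<open>r\<close>.\<close>
    assume "L_H = 0"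
    have "S \<noteq> {}"
      using S_Q_safe[OF init] by (auto simp: S_def)
    then obtain z0 where z0: "z0 \<in> S" by auto
    have H_eq: "H z = H z0" if "z \<in> D" for z
      using H_lip[OF that, of z0] z0 S_D spectral_norm_nonneg[of "H z - H z0"]
      by (auto simp: \<open>L_H = 0\<close> spectral_norm_zero_iff intro: antisym)
    then have "S = D"
      using z0 S_D by (auto simp: S_def)
    have "continuous_on UNIV H"
      using P'[of 0] r by (metis Psi.simps(1) continuous_at_imp_continuous_on has_derivative_continuous
          less_eq_Suc_le One_nat_def)
    then have "closed (H -` {A. psd A})"
      by (rule closed_vimage[OF closed_psd])
    then have "closed S"
      by (simp add: S_def vimage_def)
    then have "S = UNIV"
      using \<open>S = D\<close> D_domain(1) \<open>S \<noteq> {}\<close> clopen by blast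
    then have "H = (\<lambda>_. H z0)"
      using H_eq \<open>S = D\<close> by auto
    then obtain C where "?P (r - 1) = (\<lambda>_. C)"
      using Psi_const[of F "H z0" c "r - 1"] by metis
    then show False
      using rel_deg by (auto simp: relative_degree_def lie_agent_def lie_const)
  qed
  then have "0 < c r * L_H"
    using c_pos[of r] r consts_nonneg(1) by simp
  moreover have "0 \<le> Lhat_GH * b_u" "0 \<le> b_G * b_u"
    using consts_nonneg b_pos b_u by auto
  ultimately have \<delta>_pos: "0 < \<delta>"
    using \<Delta>t_pos consts_nonneg b_pos unfolding \<delta>_def
    by (intro mult_pos_pos) linarith+
  \<comment> \<open>Common form of feasibility at points of \<open>D\<close> and of the constraint
    on \<open>\<kappa>\<close> at sampling times.\<close>
  have top: "norm (stack su (\<lambda>i. if i \<in> \<A> then umin i z else w i)) \<le> b_u"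
      "psd (?P' (r - 1) z (F z) + ?P' (r - 1) z (G z *v stack su (\<lambda>i. if i \<in> \<A> then umin i z else w i))
        + c r *\<^sub>R ?P (r - 1) z - \<delta> *\<^sub>R mat 1)"
    if "w \<in> Pi\<^sub>E (- \<A>) U" "\<delta> *\<^sub>R mat 1 \<preceq>\<^sub>L Psi_top su \<A> umin F G H c r z w" for w z
  proof -
    show "norm (stack su (\<lambda>i. if i \<in> \<A> then umin i z else w i)) \<le> b_u"
      using that(1) umin_U by (intro stack_bound) auto
    show "psd (?P' (r - 1) z (F z) + ?P' (r - 1) z (G z *v stack su (\<lambda>i. if i \<in> \<A> then umin i z else w i))
        + c r *\<^sub>R ?P (r - 1) z - \<delta> *\<^sub>R mat 1)"
      using that(2) r by (simp add: loewner_le_def Psi_top_eq lie_F lie_G)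
  qed

  \<comment> \<open>Continuation inside \<open>S_Q\<close> past an arbitrary time\<close>
  show "x t \<in> S_Q"
  proof (rule first_exit_induct[of S_Q t0 T x])
    have "closed (?P q -` {A. psd A})" if "q < r" for q
      using P'[OF that] closed_psd
      by (meson continuous_at_imp_continuous_on closed_vimage has_derivative_continuous)
    then have "closed (\<Inter>q\<in>{..<r}. ?P q -` {A. psd A})"
      by (intro closed_INT) auto
    moreover have "S_Q = (\<Inter>q\<in>{..<r}. ?P q -` {A. psd A})"
      using S_Q_iff by auto
    ultimately show "closed S_Q" by simp
  next
    show "continuous_on {t. t0 \<le> t \<and> ereal t < T} x"
      using traj by (simp add: closed_loop_trajectory_def)
  next
    fix b assume b: "t0 \<le> b" "ereal b < T" and past: "\<And>t. t0 \<le> t \<Longrightarrow> t \<le> b \<Longrightarrow> x t \<in> S_Q"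
    \<comment> \<open>The index of the last sampling time not after \<open>b\<close>; it may be
      \<open>b\<close> itself.\<close>
    define k where "k = nat \<lfloor>(b - t0) / \<Delta>t\<rfloor>"
    define a where "a = sample_time t0 \<Delta>t k"
    have k: "real k \<le> (b - t0) / \<Delta>t" "(b - t0) / \<Delta>t < real k + 1"
      using b(1) \<Delta>t_pos unfolding k_def by (auto simp: of_nat_nat)
    have next_sample: "sample_time t0 \<Delta>t (Suc k) = a + \<Delta>t"
      by (simp add: a_def sample_time_def algebra_simps)
    have a: "t0 \<le> a" "a \<le> b" "b < a + \<Delta>t"
      using k \<Delta>t_pos by (auto simp: a_def sample_time_def field_simps)
    have aT: "ereal a < T"
      using a(2) b(2) by (metis ereal_less_eq(3) order_le_less_trans)
    define u where "u = stack su (\<lambda>i. if i \<in> \<A> then umin i (x a) else \<kappa> (x a) i)"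
    have \<kappa>_a: "\<kappa> (x a) \<in> Pi\<^sub>E (- \<A>) U" "\<delta> *\<^sub>R mat 1 \<preceq>\<^sub>L Psi_top su \<A> umin F G H c r (x a) (\<kappa> (x a))"
      using \<kappa>_safe[OF traj init, of k] aT unfolding a_def safe_inputs_def by auto
    have x': "(x has_vector_derivative F (x t) + G (x t) *v u) (at t within {a..<a + \<Delta>t})"
      if "a \<le> t" "t < a + \<Delta>t" "ereal t < T" for t
      using traj that unfolding closed_loop_trajectory_def u_def next_sample[symmetric]
      unfolding a_def by blast
    obtain b1 where b1: "b < b1" "ereal b1 < T"
      using ereal_dense2[OF b(2)] by auto
    \<comment> \<open>Between \<open>b\<close> and \<open>b2\<close> the trajectory exists and the
      input stays \<open>u\<close>.\<close>
    define b2 where "b2 = min b1 (a + \<Delta>t)"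
    have b2: "b < b2" "b2 \<le> a + \<Delta>t" "\<And>t. t < b2 \<Longrightarrow> ereal t < T"
      using b1 a by (auto simp: b2_def intro: less_trans[of _ "ereal b1"])
    \<comment> \<open>Intervals starting at \<open>b\<close> are used since at a sampling time the
      derivative is one-sided.\<close>
    have x'_right: "(x has_vector_derivative F (x t) + G (x t) *v u) (at t within {b..<b3})"
      if "b \<le> t" "t < b3" "b3 \<le> b2" for t b3
      by (rule has_vector_derivative_within_subset[OF x']) (use that b2 a in auto)
    have P_right: "((\<lambda>t. ?P q (x t)) has_vector_derivative ?P' q (x t) (F (x t) + G (x t) *v u))
        (at t within {b..<b3})" if "q < r" "b \<le> t" "t < b3" "b3 \<le> b2" for q t b3
    proof -
      have "((\<lambda>t. ?P q (x t)) has_derivative (\<lambda>h. ?P' q (x t) (h *\<^sub>R (F (x t) + G (x t) *v u))))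
          (at t within {b..<b3})"
        using has_derivative_compose[OF _ P'[OF that(1)]] x'_right[OF that(2-4)]
        unfolding has_vector_derivative_def by blast
      then show ?thesis
        by (simp add: has_vector_derivative_def linear_scale[OF P'_lin[OF that(1)]])
    qed
    have "0 < e \<bullet> (?P' (r - 1) (x b) (F (x b) + G (x b) *v u) *v e)"
      if e: "norm e = 1" "e \<bullet> (?P (r - 1) (x b) *v e) = 0" for e
    proof (rule rate_pos_at_zero[where F = F and G = G and H = H and \<psi> = "?P (r - 1)" and D = D
          and H' = "?P' 0" and \<psi>' = "?P' (r - 1)" and L_H = L_H and L_F = Lhat_FH and L_G = Lhat_GH
          and b_F = b_F and b_G = b_G and b_u = b_u and c = "c r" and \<delta> = \<delta> and \<Delta> = \<Delta>t and a = a
          and b = b and x = x and u = u and e = e])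
      show "(H has_derivative ?P' 0 z) (at z)" for z
        using P'[of 0 z] r by simp
      show "?P (r - 1) = H \<or> (\<forall>z v. ?P' 0 z (G z *v v) = 0)"
      proof (cases "r = 1")
        case False
        with r have "0 + 2 \<le> r" by simp
        then have "lie_input G (?P 0) z v = 0" for z v
          using rel_deg unfolding relative_degree_def by blast
        then show ?thesis
          using lie_G[of 0] r by auto
      qed simp
      show "spectral_norm (?P' (r - 1) y (F y) - ?P' (r - 1) z (F z)) \<le> Lhat_FH * norm (y - z)"
        if "y \<in> D" "z \<in> D" for y z
        using FPsi_lip[OF that] r by (simp add: lie_F)
      show "spectral_norm (?P' (r - 1) y (G y *v v) - ?P' (r - 1) z (G z *v v))
          \<le> Lhat_GH * norm (y - z) * norm v" if "y \<in> D" "z \<in> D" for y z v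
      proof -
        let ?T = "\<lambda>u. lie_input G (?P (r - 1)) y u - lie_input G (?P (r - 1)) z u"
        have "linear ?T"
          by (intro linear_compose_sub linear_lie_input)
        then have "spectral_norm (?T v) \<le> ind_norm ?T * norm v"
          by (rule ind_norm_bound)
        also have "\<dots> \<le> Lhat_GH * norm (y - z) * norm v"
          by (intro mult_right_mono GPsi_lip that) auto
        finally show ?thesis
          using r by (simp add: lie_G)
      qed
      show "norm (G z *v v) \<le> b_G * norm v" if "z \<in> D" for z v
        using norm_matrix_vector_le_spectral[of "G z" v] mult_right_mono[OF G_bound[OF that], of "norm v"]
        by simp
      show "\<exists>v. norm v \<le> b_u \<and> psd (?P' (r - 1) z (F z) + ?P' (r - 1) z (G z *v v)
          + c r *\<^sub>R ?P (r - 1) z - \<delta> *\<^sub>R mat 1)" if "z \<in> D" for z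
      proof -
        obtain w where "w \<in> Pi\<^sub>E (- \<A>) U" "\<delta> *\<^sub>R mat 1 \<preceq>\<^sub>L Psi_top su \<A> umin F G H c r z w"
          using MCBF \<open>z \<in> D\<close> unfolding high_order_ARZE_MCBF_def by blast
        then show ?thesis
          using top by blast
      qed
      show "continuous_on {a..b} x"
        by (rule continuous_on_subset[of "{t. t0 \<le> t \<and> ereal t < T}"])
          (use traj a b in \<open>auto simp: closed_loop_trajectory_def intro: order_le_less_trans[of _ "ereal b"]\<close>)
      show "(x has_vector_derivative F (x t) + G (x t) *v u) (at t)" if "a < t" "t < b" for t
      proof -
        have "at t within {a..<a + \<Delta>t} = at t"
          using that a by (intro at_within_interior) auto
        then show ?thesis
          using x'[of t] that a b2 by simp
      qed
      show "psd (H (x t))" if "a \<le> t" "t \<le> b" for t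
        using S_Q_safe past that a by auto
      show "psd (?P (r - 1) (x a))"
        using past[of a] a r S_Q_iff by auto
      show "norm u \<le> b_u"
        unfolding u_def by (rule top(1)[OF \<kappa>_a])
      show "psd (?P' (r - 1) (x a) (F (x a)) + ?P' (r - 1) (x a) (G (x a) *v u)
          + c r *\<^sub>R ?P (r - 1) (x a) - \<delta> *\<^sub>R mat 1)"
        unfolding u_def by (rule top(2)[OF \<kappa>_a])
    qed (use D_domain(1) safe_D P' r H_lip F_bound consts_nonneg b_pos b_u c_pos \<delta>_def \<delta>_pos \<Delta>t_pos a e
        in auto)
    moreover have "psd (?P (r - 1) (x b))"
      using past[of b] b r S_Q_iff by auto
    ultimately obtain \<epsilon> where \<epsilon>: "0 < \<epsilon>" "\<And>t. b \<le> t \<Longrightarrow> t < b + \<epsilon> \<Longrightarrow> psd (?P (r - 1) (x t))"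
      using psd_right_after[OF P_sym b2(1) P_right[of "r - 1" b b2]] r b2(1) by auto
    define b3 where "b3 = min b2 (b + \<epsilon>)"
    have b3: "b < b3" "b3 \<le> b2" "b3 \<le> b + \<epsilon>"
      using b2 \<epsilon> by (auto simp: b3_def)
    \<comment> \<open>Downward induction from level \<open>r - 1\<close>: below it the inputs drop
      out of the derivative, so member \<open>q\<close> satisfies the linear differential inequality
      whose right side is member \<open>Suc q\<close>.\<close>
    have "psd (?P (r - 1 - j) (x t))" if "j < r" "b \<le> t" "t < b3" for j t
      using that
    proof (induction j arbitrary: t)
      case 0
      then show ?case
        using \<epsilon>(2) b3 by auto
    next
      case (Suc j)
      define q where "q = r - 1 - Suc j"
      have q: "q < r" "q + 2 \<le> r" "Suc q = r - 1 - j"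
        using Suc.prems(1) by (auto simp: q_def)
      have "psd (?P q (x t))"
      proof (rule psd_of_linear_differential_inequality[OF P_sym P_right[OF q(1) _ _ b3(2)]])
        fix s assume s: "b \<le> s" "s < b3"
        have "?P' q (x s) (F (x s) + G (x s) *v u) = lie F (?P q) (x s) + lie_input G (?P q) (x s) u"
          using q(1) by (simp add: lie_F lie_G linear_add[OF P'_lin])
        also have "lie_input G (?P q) (x s) u = 0"
          using rel_deg q(2) by (simp add: relative_degree_def)
        finally have "?P' q (x s) (F (x s) + G (x s) *v u) + c (Suc q) *\<^sub>R ?P q (x s) = ?P (Suc q) (x s)"
          by simp
        then show "psd (?P' q (x s) (F (x s) + G (x s) *v u) + c (Suc q) *\<^sub>R ?P q (x s))"
          using Suc.IH[of s] Suc.prems(1) s q(3) by simp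
      next
        show "psd (?P q (x b))"
          using past[of b] b q S_Q_iff by auto
      qed (use Suc.prems in auto)
      then show ?case
        by (simp add: q_def)
    qed
    note psd_all = this
    have "x t \<in> S_Q" if "b \<le> t" "t < b3" for t
      unfolding S_Q_iff
    proof (intro allI impI)
      fix q assume "q < r"
      then show "psd (?P q (x t))"
        using psd_all[of "r - 1 - q" t] that by simp
    qed
    then show "\<exists>b'>b. \<forall>t. b \<le> t \<and> t < b' \<longrightarrow> x t \<in> S_Q"
      using b3(1) by blast
  qed (use init t in auto)
qed

end
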